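(* Let $n\ge 2$ and let $\tau_{\mathbf k}^{(\bm\beta)}$, $\mathbf k\in A_{n-1}$, $\bm\beta\in\mathbb Z^n$, be the $\tau$-functions of type $nT$ attached to the lower triangular group element $g$ (see context). Let $1\le k\le n-2$, let $I\subset\{0,1,\dots,n-1\}$ be any subset with $k$ elements and put $\delta_I=\sum_{i\in I}\delta_i$. Let $\delta_J=\sum_{a=0}^{n-1}j_a\delta_a\in\mathbb Z^n$ be any element with all $j_a\ge 0$ and $\sum_{a=0}^{n-1}j_a=k$, and put $\rho=\delta_I-\delta_J\in A_{n-1}$. Then for all $b,c\in\{0,1,\dots,n-1\}\setminus I$ with $b\neq c$, and all $\mathbf k\in A_{n-1}$, $\bm\beta\in\mathbb Z^n$, $$\tau_{\mathbf{k}+\delta_{c}-\delta_{b}}^{(\bm\beta)}\,\tau_{\mathbf{k}+\rho}^{(\bm\beta+\delta_{J})}-(-1)^{\rho\cdot(\delta_{b}-\delta_{c})}\,\epsilon(\delta_{b}-\delta_{c},\rho)\,\tau_{\mathbf{k}}^{(\bm\beta)}\,\tau_{\mathbf{k}+\rho+\delta_{c}-\delta_{b}}^{(\bm\beta+\delta_{J})}$$ $$-\sum_{i\in I}(-1)^{\rho\cdot(\delta_{i}-\delta_{c})}\,\epsilon(\delta_{i}-\delta_{c},\rho)\,\epsilon(\delta_b,\delta_c)\,\epsilon(\delta_b,\delta_i)\,\epsilon(\delta_i,\delta_c)\,\tau_{\mathbf{k}+\delta_{i}-\delta_{b}}^{(\bm\beta)}\,\tau_{\mathbf{k}+\rho+\delta_{c}-\delta_{i}}^{(\bm\beta+\delta_{J})}=0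 .$$
   Context: Lattices. $\delta_0,\dots,\delta_{n-1}$ is the standard basis of $\mathbb Z^n$, with bilinear form $\delta_a\cdot\delta_b=\delta_{ab}$. The root lattice is $A_{n-1}=\bigoplus_{i=1}^{n-1}\mathbb Z\alpha_i\subset\mathbb Z^n$, $\alpha_i=\delta_{i-1}-\delta_i$. The cocycle $\epsilon:\mathbb Z^n\times\mathbb Z^n\to\{\pm1\}$ is $\epsilon(\bm\beta,\bm\beta')=(-1)^{\sum_{a=1}^{n-1}\beta_a\sum_{b=0}^{a-1}\beta'_b}$. Fock space. $F^{(n)}$ is the semi-infinite wedge space on $H^{(n)}=\mathbb C^n\otimes\mathbb C[z,z^{-1}]$ with basis $e_az^k$ ($0\le a\le n-1$, $k\in\mathbb Z$). Put ${}_a\psi^+_{(k)}=e_az^k\wedge$ (wedging) and ${}_a\psi^-_{(k)}=i(e_az^{-k-1})$ (contraction); these satisfy $[{}_a\psi^+_{(k)},{}_b\psi^-_{(l)}]_+=\delta_{ab}\delta_{k+l,-1}$, all other anticommutators being zero. The vacuum $v_0=e_0\wedge e_1\wedge\dots\wedge e_{n-1}\wedge ze_0\wedge ze_1\wedge\cdots$ satisfies ${}_a\psi^\pm_{(k)}v_0=0$ for $k\ge0$, and $F^{(n)}$ is generated from $v_0$ by these operators. The elementary wedges $M_{n-1}\cdots M_1M_0v_0$, where $M_a=M_a^+M_a^-$ and $M_a^\pm={}_a\psi^\pm_{(k_1)}\cdots{}_a\psi^\pm_{(k_s)}$ with $k_1<\dots<k_s\le-1$, form a basis, declared orthonormal for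 the bilinear form $\langle\,,\rangle$. Fermion fields: $\psi_a^\pm(z)=\sum_k{}_a\psi^\pm_{(k)}z^{-k-1}$. Translation operators. $Q_a$ ($0\le a\le n-1$) are the invertible operators on $F^{(n)}$ determined by $Q_a^{\pm1}v_0={}_a\psi^\pm_{(-1)}v_0$, $\psi_a^\pm(z)Q_a=z^{\pm1}Q_a\psi_a^\pm(z)$, $\psi_a^\pm(z)Q_b=-Q_b\psi_a^\pm(z)$ and $Q_aQ_b=-Q_bQ_a$ for $a\ne b$. For $\bm\beta=\sum\beta_a\delta_a\in\mathbb Z^n$ put $Q^{\bm\beta}=Q_0^{\beta_0}Q_1^{\beta_1}\cdots Q_{n-1}^{\beta_{n-1}}$, and for $\mathbf k\in A_{n-1}$ put $T^{\mathbf k}=Q^{-\mathbf k}$. Group element. Let $c^{a,b}_{k,\ell}$ ($0\le b<a\le n-1$, $k,\ell\in\mathbb Z$) be formal variables (they may also be specialised to complex numbers, all but finitely many zero). Let $\Gamma_{ab}=\sum_{k,\ell\in\mathbb Z}c^{a,b}_{k,\ell}\,{}_a\psi^+_{(-k-1)}\,{}_b\psi^-_{(-\ell-1)}$ and let $g=\exp(\Gamma_{10})\exp(\Gamma_{20})\exp(\Gamma_{21})\exp(\Gamma_{30})\cdots\exp(\Gamma_{n-1,n-2})$ (pairs $(a,b)$, $a>b$, ordered by increasing $a$, then increasing $b$), a map $F^{(n)}\to F^{(n)}[[c^{a,b}_{k,\ell}]]$. It is the lift, normalised by $\langle v_0,gv_0\rangle=1$, of the infinite matrix $1+\sum_{a>b}\sum_{k,\ell}c^{a,b}_{k,\ell}E_{ab}^{-k-1,\ell}$,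 where $E_{ab}^{k,\ell}e_cz^m=\delta_{bc}\delta_{\ell m}e_az^k$. $\tau$-functions of type $nT$. $g^{(\bm\beta)}=Q^{\bm\beta}g(Q^{\bm\beta})^{-1}$ and $\tau_{\mathbf k}^{(\bm\beta)}=\langle T^{\mathbf k}v_0,g^{(\bm\beta)}v_0\rangle$. *)

theory Defs
  imports Complex_Main "HOL-Library.Multiset" "HOL-Library.Poly_Mapping"
    "HOL-Library.Function_Algebras"
begin

section \<open>Lattices\<close>

text \<open>Elements of $\mathbb{Z}^n$ are functions on the naturals that vanish from \<open>n\<close> on; they are
  added and subtracted pointwise.\<close>

definition int_lattice :: "nat \<Rightarrow> (nat \<Rightarrow> int) set" where
  "int_lattice n = {\<beta>. \<forall>a\<ge>n. \<beta> a = 0}"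

definition \<delta> :: "nat \<Rightarrow> nat \<Rightarrow> int" where
  "\<delta> a = (\<lambda>b. if b = a then 1 else 0)"

definition dot :: "nat \<Rightarrow> (nat \<Rightarrow> int) \<Rightarrow> (nat \<Rightarrow> int) \<Rightarrow> int" where
  "dot n \<beta> \<beta>' = (\<Sum>a<n. \<beta> a * \<beta>' a)"

definition simple_root :: "nat \<Rightarrow> nat \<Rightarrow> int" where
  "simple_root i = \<delta> (i - 1) - \<delta> i"

definition root_lattice :: "nat \<Rightarrow> (nat \<Rightarrow> int) set" where
  "root_lattice n = {(\<Sum>i\<in>{1..<n}. (\<lambda>b. m i * simple_root i b)) |m. True}"

text \<open>The power $(-1)^e$ for an integer exponent \<open>e\<close> of either sign, in an arbitrary ring.\<close>

definition sign_pow :: "int \<Rightarrow> 'a::ring_1" where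
  "sign_pow e = (if even e then 1 else - 1)"

definition \<epsilon> :: "nat \<Rightarrow> (nat \<Rightarrow> int) \<Rightarrow> (nat \<Rightarrow> int) \<Rightarrow> 'a::ring_1" where
  "\<epsilon> n \<beta> \<beta>' = sign_pow (\<Sum>a\<in>{1..<n}. \<beta> a * (\<Sum>b<a. \<beta>' b))"


section \<open>The semi-infinite wedge space\<close>

text \<open>The pair \<open>(k, a)\<close> stands for the basis vector $e_a z^k$ of $H^{(n)}$. The basis is ordered
  as in the vacuum: $\dots, e_0, \dots, e_{n-1}, z e_0, \dots, z e_{n-1}, z^2 e_0, \dots$\<close>

type_synonym site = "int \<times> nat"

definition precedes :: "site \<Rightarrow> site \<Rightarrow> bool" where
  "precedes s t \<longleftrightarrow> fst s < fst t \<or> (fst s = fst t \<and> snd s < snd t)"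

definition vac :: "nat \<Rightarrow> site set" where
  "vac n = {(k, a). 0 \<le> k \<and> a < n}"

text \<open>A semi-infinite monomial $u_0 \wedge u_1 \wedge \cdots$ with increasing factors $u_i$ is
  given by the set of its factors, which differs from that of the vacuum in finitely many places.\<close>

definition states :: "nat \<Rightarrow> site set set" where
  "states n = {S. S \<subseteq> UNIV \<times> {..<n} \<and> finite (S - vac n) \<and> finite (vac n - S)}"

text \<open>The Fock space is the complex vector space with basis \<open>states n\<close>.\<close>

type_synonym fock = "site set \<Rightarrow>\<^sub>0 complex"

definition smul :: "complex \<Rightarrow> fock \<Rightarrow> fock" where
  "smul c v = Poly_Mapping.map ((*) c) v"

definition Fock :: "nat \<Rightarrow> fock set" where
  "Fock n = {v. Poly_Mapping.keys v \<subseteq> states n}"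

definition v0 :: "nat \<Rightarrow> fock" where
  "v0 n = Poly_Mapping.single (vac n) 1"

text \<open>The semi-infinite monomials are orthonormal. Up to sign they are the elementary wedges
  $M_{n-1} \cdots M_0 v_0$, so this is also the form for which the latter are orthonormal.\<close>

definition pairing :: "fock \<Rightarrow> fock \<Rightarrow> complex" where
  "pairing u v = (\<Sum>S\<in>Poly_Mapping.keys u. Poly_Mapping.lookup u S * Poly_Mapping.lookup v S)"

definition lin_ext :: "(site set \<Rightarrow> fock) \<Rightarrow> fock \<Rightarrow> fock" where
  "lin_ext f v = (\<Sum>S\<in>Poly_Mapping.keys v. smul (Poly_Mapping.lookup v S) (f S))"

definition before :: "site set \<Rightarrow> site \<Rightarrow> site set" where
  "before S s = {t \<in> S. precedes t s}"

definition wedge :: "site \<Rightarrow> fock \<Rightarrow> fock" where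
  "wedge s = lin_ext (\<lambda>S. if s \<in> S then 0
     else Poly_Mapping.single (insert s S) ((-1) ^ card (before S s)))"

definition contract :: "site \<Rightarrow> fock \<Rightarrow> fock" where
  "contract s = lin_ext (\<lambda>S. if s \<in> S
     then Poly_Mapping.single (S - {s}) ((-1) ^ card (before S s)) else 0)"

definition psi_plus :: "nat \<Rightarrow> int \<Rightarrow> fock \<Rightarrow> fock" where
  "psi_plus a k = wedge (k, a)"

definition psi_minus :: "nat \<Rightarrow> int \<Rightarrow> fock \<Rightarrow> fock" where
  "psi_minus a k = contract (- k - 1, a)"


section \<open>Translation operators\<close>

text \<open>The relation $\psi^\pm_a(z) Q_a = z^{\pm 1} Q_a \psi^\pm_a(z)$ is stated for the coefficients
  of $z^{-k-1}$. Such operators exist: \<open>translation_ops_translate\<close> below.\<close>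

definition translation_ops :: "nat \<Rightarrow> (nat \<Rightarrow> fock \<Rightarrow> fock) \<Rightarrow> bool" where
  "translation_ops n Q \<longleftrightarrow>
     (\<forall>a<n. bij_betw (Q a) (Fock n) (Fock n) \<and>
        (\<forall>u\<in>Fock n. \<forall>v\<in>Fock n. Q a (u + v) = Q a u + Q a v) \<and>
        (\<forall>c. \<forall>v\<in>Fock n. Q a (smul c v) = smul c (Q a v)) \<and>
        Q a (v0 n) = psi_plus a (-1) (v0 n) \<and>
        inv_into (Fock n) (Q a) (v0 n) = psi_minus a (-1) (v0 n) \<and>
        (\<forall>k. \<forall>v\<in>Fock n. psi_plus a k (Q a v) = Q a (psi_plus a (k + 1) v)) \<and>
        (\<forall>k. \<forall>v\<in>Fock n. psi_minus a k (Q a v) = Q a (psi_minus a (k - 1) v))) \<and>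
     (\<forall>a<n. \<forall>b<n. a \<noteq> b \<longrightarrow>
        (\<forall>k. \<forall>v\<in>Fock n. psi_plus a k (Q b v) = - Q b (psi_plus a k v)) \<and>
        (\<forall>k. \<forall>v\<in>Fock n. psi_minus a k (Q b v) = - Q b (psi_minus a k v)) \<and>
        (\<forall>v\<in>Fock n. Q a (Q b v) = - Q b (Q a v)))"

definition Q_int_pow :: "nat \<Rightarrow> (nat \<Rightarrow> fock \<Rightarrow> fock) \<Rightarrow> nat \<Rightarrow> int \<Rightarrow> fock \<Rightarrow> fock" where
  "Q_int_pow n Q a m = (if 0 \<le> m then Q a ^^ nat m else inv_into (Fock n) (Q a) ^^ nat (- m))"

definition Q_lattice :: "nat \<Rightarrow> (nat \<Rightarrow> fock \<Rightarrow> fock) \<Rightarrow> (nat \<Rightarrow> int) \<Rightarrow> fock \<Rightarrow> fock" where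
  "Q_lattice n Q \<beta> = foldr (\<lambda>a. (\<circ>) (Q_int_pow n Q a (\<beta> a))) [0..<n] id"

definition T_lattice :: "nat \<Rightarrow> (nat \<Rightarrow> fock \<Rightarrow> fock) \<Rightarrow> (nat \<Rightarrow> int) \<Rightarrow> fock \<Rightarrow> fock" where
  "T_lattice n Q k = Q_lattice n Q (- k)"


section \<open>Formal power series in arbitrarily many variables\<close>

text \<open>A monomial in variables of type \<open>'v\<close> is a finite multiset of variables.\<close>

typedef 'v mseries = "UNIV :: ('v multiset \<Rightarrow> complex) set"
  morphisms mcoeff Mseries ..

lemma mcoeff_Mseries [simp]: "mcoeff (Mseries f) = f"
  by (simp add: Mseries_inverse)

lemma mseries_eqI: "(\<And>m. mcoeff f m = mcoeff g m) \<Longrightarrow> f = g"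
  by (metis ext mcoeff_inject)

lemma finite_submultisets: "finite {p. p \<subseteq># (m :: 'v multiset)}"
proof (induction m)
  case (add x m)
  have "{p. p \<subseteq># add_mset x m} \<subseteq> {p. p \<subseteq># m} \<union> add_mset x ` {p. p \<subseteq># m}"
  proof
    fix p assume "p \<in> {p. p \<subseteq># add_mset x m}"
    then have p: "p \<subseteq># add_mset x m" by simp
    show "p \<in> {p. p \<subseteq># m} \<union> add_mset x ` {p. p \<subseteq># m}"
    proof (cases "x \<in># p")
      case True
      then obtain q where "p = add_mset x q" by (metis multi_member_split)
      with p show ?thesis by auto
    next
      case False
      with p have "p \<subseteq># m"
        by (metis diff_single_trivial subset_eq_diff_conv add_mset_add_single)
      then show ?thesis by simp
    qed
  qed
  with add show ?case by (metis finite_UnI finite_imageI finite_subset)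
qed simp

lemma finite_splittings: "finite {(p, q). p + q = (m :: 'v multiset)}"
  by (rule finite_subset[OF _ finite_cartesian_product[OF finite_submultisets[of m] finite_submultisets[of m]]])
     auto

lemma finite_splittings3: "finite {(p, q, r). p + q + r = (m :: 'v multiset)}"
  by (rule finite_subset[OF _ finite_cartesian_product[OF finite_submultisets[of m]
        finite_cartesian_product[OF finite_submultisets[of m] finite_submultisets[of m]]]])
     (auto simp: subset_mset.le_iff_add ac_simps)

instantiation mseries :: (type) comm_ring_1
begin

definition zero_mseries_def: "0 = Mseries (\<lambda>m. 0)"
definition one_mseries_def: "1 = Mseries (\<lambda>m. if m = {#} then 1 else 0)"
definition plus_mseries_def: "f + g = Mseries (\<lambda>m. mcoeff f m + mcoeff g m)"
definition minus_mseries_def: "f - g = Mseries (\<lambda>m. mcoeff f m - mcoeff g m)"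
definition uminus_mseries_def: "- f = Mseries (\<lambda>m. - mcoeff f m)"
definition times_mseries_def:
  "f * g = Mseries (\<lambda>m. \<Sum>(p, q)\<in>{(p, q). p + q = m}. mcoeff f p * mcoeff g q)"

instance
proof
  fix f g h :: "'a mseries"
  show "f * g * h = f * (g * h)"
  proof (rule mseries_eqI)
    fix m
    let ?F = "\<lambda>(p, q, r). mcoeff f p * mcoeff g q * mcoeff h r"
    have "mcoeff (f * g * h) m =
        (\<Sum>x\<in>{(p, q). p + q = m}. \<Sum>y\<in>{(p, q). p + q = fst x}.
           mcoeff f (fst y) * mcoeff g (snd y) * mcoeff h (snd x))"
      by (auto simp: times_mseries_def sum_distrib_right case_prod_beta intro!: sum.cong)
    also have "\<dots> = (\<Sum>(x, y)\<in>(SIGMA x:{(p, q). p + q = m}. {(p, q). p + q = fst x}).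
           mcoeff f (fst y) * mcoeff g (snd y) * mcoeff h (snd x))"
      by (rule sum.Sigma) (use finite_splittings in auto)
    also have "\<dots> = sum ?F {(p, q, r). p + q + r = m}"
      by (rule sum.reindex_bij_witness[where i = "\<lambda>(p, q, r). ((p + q, r), (p, q))"
            and j = "\<lambda>((s, r), (p, q)). (p, q, r)"]) auto
    also have "\<dots> = (\<Sum>(x, y)\<in>(SIGMA x:{(p, q). p + q = m}. {(p, q). p + q = snd x}).
           mcoeff f (fst x) * mcoeff g (fst y) * mcoeff h (snd y))"
      by (rule sum.reindex_bij_witness[where j = "\<lambda>(p, q, r). ((p, q + r), (q, r))"
            and i = "\<lambda>((p, s), (q, r)). (p, q, r)"]) (auto simp: ac_simps)
    also have "\<dots> = (\<Sum>x\<in>{(p, q). p + q = m}. \<Sum>y\<in>{(p, q). p + q = snd x}.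
           mcoeff f (fst x) * mcoeff g (fst y) * mcoeff h (snd y))"
      by (rule sum.Sigma[symmetric]) (use finite_splittings in auto)
    also have "\<dots> = mcoeff (f * (g * h)) m"
      by (auto simp: times_mseries_def sum_distrib_left case_prod_beta mult.assoc intro!: sum.cong)
    finally show "mcoeff (f * g * h) m = mcoeff (f * (g * h)) m" .
  qed
  show "f * g = g * f"
  proof (rule mseries_eqI)
    fix m
    show "mcoeff (f * g) m = mcoeff (g * f) m"
      unfolding times_mseries_def mcoeff_Mseries
      by (rule sum.reindex_bij_witness[where i = "\<lambda>(p, q). (q, p)" and j = "\<lambda>(p, q). (q, p)"])
         (auto simp: ac_simps)
  qed
  show "1 * f = f"
  proof (rule mseries_eqI)
    fix m
    have "mcoeff (1 * f) m = (\<Sum>x\<in>{(p, q). p + q = m}. if x = ({#}, m) then mcoeff f m else 0)"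
      unfolding times_mseries_def one_mseries_def mcoeff_Mseries by (rule sum.cong) (auto split: if_splits)
    also have "\<dots> = mcoeff f m"
      by (simp add: finite_splittings)
    finally show "mcoeff (1 * f) m = mcoeff f m" .
  qed
  show "(f + g) * h = f * h + g * h"
    by (rule mseries_eqI)
       (simp add: times_mseries_def plus_mseries_def case_prod_beta distrib_right sum.distrib)
  show "(0 :: 'a mseries) \<noteq> 1"
  proof
    assume "(0 :: 'a mseries) = 1"
    then have "mcoeff (0 :: 'a mseries) {#} = mcoeff 1 {#}" by simp
    then show False by (simp add: zero_mseries_def one_mseries_def)
  qed
qed (auto simp: plus_mseries_def minus_mseries_def uminus_mseries_def zero_mseries_def
      algebra_simps intro!: mseries_eqI)

end

text \<open>Substitution of numbers \<open>x\<close> for the variables, when all but finitely many of them are zero.\<close>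

definition specialise :: "('v \<Rightarrow> complex) \<Rightarrow> 'v mseries \<Rightarrow> complex" where
  "specialise x f =
     (\<Sum>m | mcoeff f m \<noteq> 0 \<and> (\<forall>c\<in>#m. x c \<noteq> 0). mcoeff f m * (\<Prod>c\<in>#m. x c))"


section \<open>The group element and the \<open>\<tau>\<close>-functions\<close>

text \<open>The tuple \<open>(a, b, k, l)\<close> is the variable $c^{a,b}_{k,l}$. A function from monomials to \<open>fock\<close>
  is a power series in these variables with coefficients in the Fock space.\<close>

type_synonym cvar = "nat \<times> nat \<times> int \<times> int"
type_synonym fock_series = "cvar multiset \<Rightarrow> fock"

text \<open>The coefficient at \<open>m\<close> of $\sum_{k,l} c^{a,b}_{k,l}\, X_{k,l} V$ is the sum of
  $X_{k,l}\, V(m / c^{a,b}_{k,l})$ over those \<open>(k, l)\<close> for which $c^{a,b}_{k,l}$ divides \<open>m\<close>.\<close>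

definition Gamma :: "nat \<Rightarrow> nat \<Rightarrow> fock_series \<Rightarrow> fock_series" where
  "Gamma a b V = (\<lambda>m. \<Sum>(k, l)\<in>{(k, l). (a, b, k, l) \<in># m}.
     psi_plus a (- k - 1) (psi_minus b (- l - 1) (V (m - {#(a, b, k, l)#}))))"

text \<open>\<open>Gamma a b\<close> raises the degree by one, so the powers beyond \<open>size m\<close> do not contribute to the
  coefficient at \<open>m\<close>.\<close>

definition exp_Gamma :: "nat \<Rightarrow> nat \<Rightarrow> fock_series \<Rightarrow> fock_series" where
  "exp_Gamma a b V = (\<lambda>m. \<Sum>s\<le>size m. smul (1 / fact s) ((Gamma a b ^^ s) V m))"

definition group_elt_series :: "nat \<Rightarrow> fock_series \<Rightarrow> fock_series" where
  "group_elt_series n = foldr (\<lambda>(a, b). (\<circ>) (exp_Gamma a b)) [(a, b). a \<leftarrow> [0..<n], b \<leftarrow> [0..<a]] id"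

definition group_elt :: "nat \<Rightarrow> fock \<Rightarrow> fock_series" where
  "group_elt n v = group_elt_series n (\<lambda>m. if m = {#} then v else 0)"

definition conj_group_elt :: "nat \<Rightarrow> (nat \<Rightarrow> fock \<Rightarrow> fock) \<Rightarrow> (nat \<Rightarrow> int) \<Rightarrow> fock \<Rightarrow> fock_series" where
  "conj_group_elt n Q \<beta> v = (\<lambda>m. Q_lattice n Q \<beta> (group_elt n (inv_into (Fock n) (Q_lattice n Q \<beta>) v) m))"

definition tau ::
    "nat \<Rightarrow> (nat \<Rightarrow> fock \<Rightarrow> fock) \<Rightarrow> (nat \<Rightarrow> int) \<Rightarrow> (nat \<Rightarrow> int) \<Rightarrow> cvar mseries" where
  "tau n Q k \<beta> = Mseries (\<lambda>m. pairing (T_lattice n Q k (v0 n)) (conj_group_elt n Q \<beta> (v0 n) m))"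


section \<open>Existence of the translation operators\<close>

lemma lookup_smul [simp]: "Poly_Mapping.lookup (smul c v) S = c * Poly_Mapping.lookup v S"
  by (simp add: smul_def Poly_Mapping.map.rep_eq when_def)

lemma smul_simps [simp]:
  "smul c (u + v) = smul c u + smul c v" "smul (c + d) v = smul c v + smul d v"
  "smul c (smul d v) = smul (c * d) v" "smul 0 v = 0" "smul c 0 = 0" "smul 1 v = v"
  "smul c (- v) = - smul c v"
  "smul c (Poly_Mapping.single S d) = Poly_Mapping.single S (c * d)"
  by (auto intro!: poly_mapping_eqI simp: lookup_add algebra_simps lookup_single when_def)

lemma smul_sum: "smul c (\<Sum>i\<in>A. f i) = (\<Sum>i\<in>A. smul c (f i))"
  by (induction A rule: infinite_finite_induct) auto

lemma lin_ext_superset: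
  assumes "finite A" "Poly_Mapping.keys v \<subseteq> A"
  shows "lin_ext f v = (\<Sum>S\<in>A. smul (Poly_Mapping.lookup v S) (f S))"
  unfolding lin_ext_def using assms by (intro sum.mono_neutral_left) (auto simp: in_keys_iff)

lemma lin_ext_add: "lin_ext f (u + v) = lin_ext f u + lin_ext f v"
proof -
  let ?A = "Poly_Mapping.keys u \<union> Poly_Mapping.keys v"
  have "Poly_Mapping.keys (u + v) \<subseteq> ?A" by (rule Poly_Mapping.keys_add)
  then show ?thesis
    by (simp add: lin_ext_superset[of ?A] lookup_add sum.distrib)
qed

lemma lin_ext_smul: "lin_ext f (smul c v) = smul c (lin_ext f v)"
proof -
  have "Poly_Mapping.keys (smul c v) \<subseteq> Poly_Mapping.keys v" by (auto simp: in_keys_iff)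
  then show ?thesis
    by (simp add: lin_ext_superset[of "Poly_Mapping.keys v"] smul_sum)
qed

lemma lin_ext_zero [simp]: "lin_ext f 0 = 0"
  by (simp add: lin_ext_def)

lemma lin_ext_uminus: "lin_ext f (- v) = - lin_ext f v"
  using lin_ext_add[of f v "- v"] by (simp add: eq_neg_iff_add_eq_0 add.commute)

lemma lin_ext_sum: "lin_ext f (\<Sum>i\<in>A. h i) = (\<Sum>i\<in>A. lin_ext f (h i))"
  by (induction A rule: infinite_finite_induct) (auto simp: lin_ext_add)

lemma lin_ext_single [simp]: "lin_ext f (Poly_Mapping.single S c) = smul c (f S)"
  by (simp add: lin_ext_def)

lemma fock_expand:
  "v = (\<Sum>S\<in>Poly_Mapping.keys v. Poly_Mapping.single S (Poly_Mapping.lookup v S))"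
  by (rule poly_mapping_eqI)
     (simp add: lookup_sum lookup_single when_def if_distrib in_keys_iff cong: if_cong)

lemma linear_eqI:
  assumes "v \<in> Fock n"
    and A: "\<And>u v. A (u + v) = A u + A v" "A 0 = 0"
    and B: "\<And>u v. B (u + v) = B u + B v" "B 0 = 0"
    and eq: "\<And>S c. S \<in> states n \<Longrightarrow> A (Poly_Mapping.single S c) = B (Poly_Mapping.single S c)"
  shows "A v = (B v :: fock)"
proof -
  have sumA: "A (\<Sum>i\<in>X. h i) = (\<Sum>i\<in>X. A (h i))" for X and h :: "site set \<Rightarrow> fock"
    by (induction X rule: infinite_finite_induct) (auto simp: A)
  have sumB: "B (\<Sum>i\<in>X. h i) = (\<Sum>i\<in>X. B (h i))" for X and h :: "site set \<Rightarrow> fock"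
    by (induction X rule: infinite_finite_induct) (auto simp: B)
  have "A v = (\<Sum>S\<in>Poly_Mapping.keys v. A (Poly_Mapping.single S (Poly_Mapping.lookup v S)))"
    by (subst fock_expand[of v], subst sumA) (rule refl)
  also have "\<dots> = (\<Sum>S\<in>Poly_Mapping.keys v. B (Poly_Mapping.single S (Poly_Mapping.lookup v S)))"
    using assms(1) by (intro sum.cong refl eq) (auto simp: Fock_def)
  also have "\<dots> = B v"
    by (subst (2) fock_expand[of v], subst sumB) (rule refl)
  finally show ?thesis .
qed

lemma Fock_zero: "0 \<in> Fock n"
  by (simp add: Fock_def)

lemma Fock_add: "u \<in> Fock n \<Longrightarrow> v \<in> Fock n \<Longrightarrow> u + v \<in> Fock n"
  using Poly_Mapping.keys_add[of u v] by (auto simp: Fock_def)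

lemma Fock_smul: "v \<in> Fock n \<Longrightarrow> smul c v \<in> Fock n"
  by (auto simp: Fock_def in_keys_iff)

lemma Fock_single: "S \<in> states n \<Longrightarrow> Poly_Mapping.single S c \<in> Fock n"
  by (simp add: Fock_def)

lemma Fock_sum: "(\<And>i. i \<in> A \<Longrightarrow> h i \<in> Fock n) \<Longrightarrow> (\<Sum>i\<in>A. h i) \<in> Fock n"
  by (induction A rule: infinite_finite_induct) (auto simp: Fock_zero Fock_add)

lemma Fock_lin_ext:
  "v \<in> Fock n \<Longrightarrow> (\<And>S. S \<in> states n \<Longrightarrow> f S \<in> Fock n) \<Longrightarrow> lin_ext f v \<in> Fock n"
  unfolding lin_ext_def by (intro Fock_sum Fock_smul) (auto simp: Fock_def)

lemma wedge_single: "wedge s (Poly_Mapping.single S c) =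
    (if s \<in> S then 0 else Poly_Mapping.single (insert s S) (c * (-1) ^ card (before S s)))"
  by (simp add: wedge_def)

lemma contract_single: "contract s (Poly_Mapping.single S c) =
    (if s \<in> S then Poly_Mapping.single (S - {s}) (c * (-1) ^ card (before S s)) else 0)"
  by (simp add: contract_def)

lemmas wedge_add = lin_ext_add[where f = "\<lambda>S. if s \<in> S then 0
     else Poly_Mapping.single (insert s S) ((-1) ^ card (before S s))" for s, folded wedge_def]
lemmas contract_add = lin_ext_add[where f = "\<lambda>S. if s \<in> S
     then Poly_Mapping.single (S - {s}) ((-1) ^ card (before S s)) else 0" for s, folded contract_def]

lemma wedge_zero [simp]: "wedge s 0 = 0" and contract_zero [simp]: "contract s 0 = 0"
  by (simp_all add: wedge_def contract_def)

lemma wedge_uminus: "wedge s (- v) = - wedge s v" and contract_uminus: "contract s (- v) = - contract s v"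
  by (simp_all add: wedge_def contract_def lin_ext_uminus)

lemma finite_vac_before: "finite {t \<in> vac n. precedes t s}"
proof (rule finite_subset)
  show "{t \<in> vac n. precedes t s} \<subseteq> {0..fst s} \<times> {..<n}"
    by (auto simp: vac_def precedes_def)
qed simp

lemma finite_before:
  assumes "S \<in> states n"
  shows "finite (before S s)"
proof (rule finite_subset)
  show "before S s \<subseteq> (S - vac n) \<union> {t \<in> vac n. precedes t s}"
    by (auto simp: before_def)
  show "finite ((S - vac n) \<union> {t \<in> vac n. precedes t s})"
    using assms finite_vac_before by (auto simp: states_def)
qed

lemma vac_states: "vac n \<in> states n"
  by (auto simp: states_def vac_def)

lemma insert_states:
  assumes "S \<in> states n" "snd s < n" shows "insert s S \<in> states n"
proof -
  have "vac n - insert s S \<subseteq> vac n - S" "insert s S - vac n \<subseteq> insert s (S - vac n)" by auto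
  moreover have "insert s S \<subseteq> UNIV \<times> {..<n}" using assms by (cases s) (auto simp: states_def)
  ultimately show ?thesis
    using assms(1) unfolding states_def by (metis (mono_tags, lifting) finite_insert finite_subset mem_Collect_eq)
qed

lemma remove_states:
  assumes S: "S \<in> states n" shows "S - {s} \<in> states n"
proof -
  have "vac n - (S - {s}) \<subseteq> insert s (vac n - S)" "S - {s} - vac n \<subseteq> S - vac n" by auto
  moreover have "S - {s} \<subseteq> UNIV \<times> {..<n}" using S by (auto simp: states_def)
  ultimately show ?thesis
    using S unfolding states_def by (metis (mono_tags, lifting) finite_insert finite_subset mem_Collect_eq)
qed

lemma states_snd: "S \<in> states n \<Longrightarrow> s \<in> S \<Longrightarrow> snd s < n"
  by (auto simp: states_def)

lemma Fock_wedge: "v \<in> Fock n \<Longrightarrow> snd s < n \<Longrightarrow> wedge s v \<in> Fock n"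
  unfolding wedge_def by (rule Fock_lin_ext) (auto intro: Fock_single Fock_zero insert_states)

lemma Fock_contract: "v \<in> Fock n \<Longrightarrow> contract s v \<in> Fock n"
  unfolding contract_def by (rule Fock_lin_ext) (auto intro: Fock_single Fock_zero remove_states)

lemma states_induct [consumes 1, case_names vac insert remove]:
  assumes "S \<in> states n"
    and vac: "P (vac n)"
    and ins: "\<And>S s. S \<in> states n \<Longrightarrow> P S \<Longrightarrow> snd s < n \<Longrightarrow> s \<notin> S \<Longrightarrow> P (insert s S)"
    and rem: "\<And>S s. S \<in> states n \<Longrightarrow> P S \<Longrightarrow> s \<in> S \<Longrightarrow> P (S - {s})"
  shows "P S"
proof -
  have 1: "P (vac n \<union> X)" if "finite X" "X \<subseteq> UNIV \<times> {..<n}" "X \<inter> vac n = {}" for X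
    using that
  proof (induction X rule: finite_induct)
    case (insert x X)
    have "vac n \<union> X \<in> states n"
      using insert.prems insert.hyps vac_states[of n]
      by (auto simp: states_def Un_Diff intro: finite_subset[of _ X])
    then have "P (insert x (vac n \<union> X))"
      using insert by (intro ins) auto
    then show ?case by simp
  qed (use vac in simp)
  have S: "S \<subseteq> UNIV \<times> {..<n}" "finite (S - vac n)" "finite (vac n - S)"
    using assms(1) by (auto simp: states_def)
  have 2: "P ((vac n \<union> S) - Y)" if "finite Y" "Y \<subseteq> vac n - S" for Y
    using that
  proof (induction Y rule: finite_induct)
    case empty
    have "P (vac n \<union> (S - vac n))" using S by (intro 1) auto
    then show ?case by simp
  next
    case (insert y Y)
    have "(vac n \<union> S) - Y \<in> states n"
    proof -
      have "vac n - (vac n \<union> S - Y) \<subseteq> vac n - S" using insert.prems by auto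
      moreover have "vac n \<union> S - Y - vac n \<subseteq> S - vac n" by auto
      moreover have "vac n \<union> S - Y \<subseteq> UNIV \<times> {..<n}" using S by (auto simp: vac_def)
      ultimately show ?thesis using S unfolding states_def
        by (auto intro: finite_subset)
    qed
    then have "P (((vac n \<union> S) - Y) - {y})"
      using insert by (intro rem) auto
    moreover have "((vac n \<union> S) - Y) - {y} = (vac n \<union> S) - insert y Y" by auto
    ultimately show ?case by simp
  qed
  have "P ((vac n \<union> S) - (vac n - S))" using S by (intro 2) auto
  moreover have "(vac n \<union> S) - (vac n - S) = S" by auto
  ultimately show ?thesis by simp
qed

text \<open>\<open>shift a\<close> multiplies the vectors of component \<open>a\<close> by $z^{-1}$. Among the vectors of component
  \<open>a\<close>, only \<open>partner a s\<close> changes its position relative to a given \<open>s\<close> of another component.\<close>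

definition shift :: "nat \<Rightarrow> site \<Rightarrow> site" where
  "shift a s = (if snd s = a then (fst s - 1, a) else s)"

definition unshift :: "nat \<Rightarrow> site \<Rightarrow> site" where
  "unshift a s = (if snd s = a then (fst s + 1, a) else s)"

definition partner :: "nat \<Rightarrow> site \<Rightarrow> site" where
  "partner a s = (if a < snd s then (fst s + 1, a) else (fst s, a))"

definition unpaired :: "nat \<Rightarrow> site set \<Rightarrow> site set" where
  "unpaired a S = {s \<in> S. snd s \<noteq> a \<and> partner a s \<notin> S}"

definition translate :: "nat \<Rightarrow> fock \<Rightarrow> fock" where
  "translate a = lin_ext (\<lambda>S. Poly_Mapping.single (shift a ` S) ((-1) ^ card (unpaired a S)))"

definition untranslate :: "nat \<Rightarrow> fock \<Rightarrow> fock" where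
  "untranslate a = lin_ext (\<lambda>S. Poly_Mapping.single (unshift a ` S)
     ((-1) ^ card (unpaired a (unshift a ` S))))"

lemma shift_unshift [simp]: "shift a (unshift a s) = s" "unshift a (shift a s) = s"
  by (cases s; simp add: shift_def unshift_def)+

lemma shift_image [simp]: "shift a ` unshift a ` S = S" "unshift a ` shift a ` S = S"
  by (simp_all add: image_image)

lemma inj_shift: "inj (shift a)"
  by (metis injI shift_unshift(2))

lemma snd_shift [simp]: "snd (shift a s) = snd s" "snd (unshift a s) = snd s"
  by (simp_all add: shift_def unshift_def)

lemma shift_mem_iff [simp]: "shift a s \<in> shift a ` S \<longleftrightarrow> s \<in> S"
  by (rule inj_image_mem_iff[OF inj_shift])

lemma states_shift:
  assumes "S \<in> states n" "a < n" shows "shift a ` S \<in> states n"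
proof -
  have sub: "vac n \<subseteq> shift a ` vac n"
  proof
    fix s assume "s \<in> vac n"
    then have "unshift a s \<in> vac n" by (auto simp: vac_def unshift_def)
    then show "s \<in> shift a ` vac n" by (metis imageI shift_unshift(1))
  qed
  have "shift a ` S - vac n \<subseteq> shift a ` (S - vac n) \<union> {(-1, a)}"
    by (auto simp: vac_def shift_def image_iff split: if_splits)
  moreover have "vac n - shift a ` S \<subseteq> shift a ` (vac n - S)"
    using sub by (auto simp: image_iff)
  moreover have "shift a ` S \<subseteq> UNIV \<times> {..<n}"
    using assms by (auto simp: states_def shift_def)
  ultimately show ?thesis
    using assms(1) unfolding states_def
    by (auto elim!: finite_subset)
qed

lemma states_unshift:
  assumes "S \<in> states n" "a < n" shows "unshift a ` S \<in> states n"
proof -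
  have sub: "unshift a ` vac n \<subseteq> vac n"
    by (auto simp: vac_def unshift_def)
  have "unshift a ` S - vac n \<subseteq> unshift a ` (S - vac n)"
    using sub by auto
  moreover have "vac n - unshift a ` S \<subseteq> unshift a ` (vac n - S) \<union> {(0, a)}"
  proof
    fix s assume s: "s \<in> vac n - unshift a ` S"
    then have "shift a s \<notin> S" by (metis DiffD2 imageI shift_unshift(2))
    moreover have "s = (0, a) \<or> shift a s \<in> vac n"
      using s by (cases s) (auto simp: vac_def shift_def)
    ultimately show "s \<in> unshift a ` (vac n - S) \<union> {(0, a)}"
      by (metis DiffI Un_iff imageI insertI1 shift_unshift(2))
  qed
  moreover have "unshift a ` S \<subseteq> UNIV \<times> {..<n}"
    using assms by (auto simp: states_def unshift_def)
  ultimately show ?thesis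
    using assms(1) unfolding states_def
    by (auto elim!: finite_subset)
qed

lemma finite_unpaired:
  assumes S: "S \<in> states n" and a: "a < n"
  shows "finite (unpaired a S)"
proof (rule finite_subset)
  let ?f = "\<lambda>(p :: site, b). (if a < b then fst p - 1 else fst p, b)"
  show "unpaired a S \<subseteq> (S - vac n) \<union> ?f ` ((vac n - S) \<times> {..<n})"
  proof
    fix s assume s: "s \<in> unpaired a S"
    show "s \<in> (S - vac n) \<union> ?f ` ((vac n - S) \<times> {..<n})"
    proof (cases "s \<in> vac n")
      case True
      then have "(partner a s, snd s) \<in> (vac n - S) \<times> {..<n}"
        using s a by (auto simp: unpaired_def partner_def vac_def split: if_splits)
      moreover have "s = ?f (partner a s, snd s)"
        by (cases s) (simp add: partner_def)
      ultimately show ?thesis by blast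
    next
      case False then show ?thesis using s by (auto simp: unpaired_def)
    qed
  qed
  show "finite ((S - vac n) \<union> ?f ` ((vac n - S) \<times> {..<n}))"
    using S by (auto simp: states_def)
qed

lemma card_before_shift: "card (before (shift a ` S) s) = card {t \<in> S. precedes (shift a t) s}"
proof -
  have "before (shift a ` S) s = shift a ` {t \<in> S. precedes (shift a t) s}"
    by (auto simp: before_def)
  then show ?thesis by (simp add: card_image inj_on_subset[OF inj_shift])
qed

lemma sign_other:
  assumes S: "S \<in> states n" and a: "a < n" and s: "s \<notin> S" "snd s \<noteq> a"
  shows "(-1 :: complex) ^ (card (unpaired a S) + card (before (shift a ` S) s)) =
         - ((-1) ^ (card (unpaired a (insert s S)) + card (before S s)))"
proof -
  have 1: "{t \<in> S. precedes (shift a t) s} =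
      (if partner a s \<in> S then insert (partner a s) (before S s) else before S s)"
  proof -
    have "precedes (shift a t) s \<longleftrightarrow> t = partner a s \<or> precedes t s" for t
      using s(2) by (cases t; cases s) (auto simp: precedes_def shift_def partner_def)
    then show ?thesis by (auto simp: before_def)
  qed
  have p: "partner a s \<notin> before S s"
    by (auto simp: before_def precedes_def partner_def split: if_splits)
  have 2: "card (before (shift a ` S) s) = card (before S s) + (if partner a s \<in> S then 1 else 0)"
    unfolding card_before_shift 1 using finite_before[OF S] p by simp
  have "partner a t \<noteq> s" for t using s(2) by (auto simp: partner_def)
  then have "unpaired a (insert s S) =
      (if partner a s \<in> S then unpaired a S else insert s (unpaired a S))"
    using s by (auto simp: unpaired_def)
  then have 3: "card (unpaired a (insert s S)) =
      card (unpaired a S) + (if partner a s \<in> S then 0 else 1)"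
    using finite_unpaired[OF S a] s by (auto simp: unpaired_def)
  show ?thesis unfolding 2 3 by (simp add: power_add)
qed

lemma sign_same:
  assumes S: "S \<in> states n" and a: "a < n" and s: "s \<notin> S" "snd s = a"
  shows "(-1 :: complex) ^ (card (unpaired a S) + card (before (shift a ` S) (shift a s))) =
         (-1) ^ (card (unpaired a (insert s S)) + card (before S s))"
proof -
  let ?X = "{t \<in> S. snd t \<noteq> a \<and> partner a t = s}"
  have 1: "precedes t s \<longleftrightarrow> precedes (shift a t) (shift a s) \<or> (snd t \<noteq> a \<and> partner a t = s)"
    and excl: "\<not> (precedes (shift a t) (shift a s) \<and> (snd t \<noteq> a \<and> partner a t = s))" for t
    using s(2) by (cases t; cases s; auto simp: precedes_def shift_def partner_def)+
  have B: "before S s = {t \<in> S. precedes (shift a t) (shift a s)} \<union> ?X"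
    using 1 by (auto simp: before_def)
  have fin: "finite ?X" "finite {t \<in> S. precedes (shift a t) (shift a s)}"
    using finite_before[OF S, of s] unfolding B by auto
  have 2: "card (before S s) = card (before (shift a ` S) (shift a s)) + card ?X"
    unfolding card_before_shift B using fin excl by (intro card_Un_disjoint) auto
  have U: "unpaired a S = unpaired a (insert s S) \<union> ?X"
    using s by (auto simp: unpaired_def)
  have "finite (unpaired a (insert s S))"
    using finite_unpaired[OF S a] unfolding U by simp
  then have 3: "card (unpaired a S) = card (unpaired a (insert s S)) + card ?X"
    unfolding U using fin by (intro card_Un_disjoint) (auto simp: unpaired_def)
  show ?thesis unfolding 2 3 by (simp add: power_add)
qed

lemma translate_single: "translate a (Poly_Mapping.single S c) =
    Poly_Mapping.single (shift a ` S) (c * (-1) ^ card (unpaired a S))"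
  by (simp add: translate_def)

lemma translate_linear [simp]:
  "translate a (u + v) = translate a u + translate a v"
  "translate a (smul c v) = smul c (translate a v)" "translate a 0 = 0"
  "translate a (- v) = - translate a v"
  by (simp_all add: translate_def lin_ext_add lin_ext_smul lin_ext_uminus)

lemma Fock_translate: "v \<in> Fock n \<Longrightarrow> a < n \<Longrightarrow> translate a v \<in> Fock n"
  unfolding translate_def by (rule Fock_lin_ext) (auto intro: Fock_single states_shift)

lemma Fock_untranslate: "v \<in> Fock n \<Longrightarrow> a < n \<Longrightarrow> untranslate a v \<in> Fock n"
  unfolding untranslate_def by (rule Fock_lin_ext) (auto intro: Fock_single states_unshift)

lemma bij_translate:
  assumes a: "a < n" shows "bij_betw (translate a) (Fock n) (Fock n)"
proof (rule bij_betw_byWitness[where f' = "untranslate a"])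
  show "\<forall>v\<in>Fock n. untranslate a (translate a v) = v"
  proof
    fix v assume v: "v \<in> Fock n"
    show "untranslate a (translate a v) = v"
      by (rule linear_eqI[OF v])
        (simp_all add: translate_def untranslate_def lin_ext_add mult.assoc flip: power_add)
  qed
  show "\<forall>v\<in>Fock n. translate a (untranslate a v) = v"
  proof
    fix v assume v: "v \<in> Fock n"
    show "translate a (untranslate a v) = v"
      by (rule linear_eqI[OF v])
        (simp_all add: translate_def untranslate_def lin_ext_add mult.assoc flip: power_add)
  qed
qed (use a Fock_translate Fock_untranslate in auto)

lemma wedge_translate_other:
  assumes v: "v \<in> Fock n" and a: "a < n" and s: "snd s \<noteq> a"
  shows "wedge s (translate a v) = - translate a (wedge s v)"
proof (rule linear_eqI[OF v])
  fix S c assume S: "S \<in> states n"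
  have sh: "shift a s = s" using s by (simp add: shift_def)
  have mem: "s \<in> shift a ` S \<longleftrightarrow> s \<in> S" using shift_mem_iff[of a s S] sh by simp
  show "wedge s (translate a (Poly_Mapping.single S c)) =
      - translate a (wedge s (Poly_Mapping.single S c))"
  proof (cases "s \<in> S")
    case False
    show ?thesis
      using sign_other[OF S a False s] False mem sh
      by (simp add: wedge_single translate_single mult.assoc single_uminus power_add ac_simps)
  qed (simp add: wedge_single translate_single mem)
qed (simp_all add: wedge_add)

lemma contract_translate_other:
  assumes v: "v \<in> Fock n" and a: "a < n" and s: "snd s \<noteq> a"
  shows "contract s (translate a v) = - translate a (contract s v)"
proof (rule linear_eqI[OF v])
  fix S c assume S: "S \<in> states n"
  have sh: "shift a s = s" using s by (simp add: shift_def)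
  have mem: "s \<in> shift a ` S \<longleftrightarrow> s \<in> S" using shift_mem_iff[of a s S] sh by simp
  show "contract s (translate a (Poly_Mapping.single S c)) =
      - translate a (contract s (Poly_Mapping.single S c))"
  proof (cases "s \<in> S")
    case True
    define R where "R = S - {s}"
    have R: "R \<in> states n" "s \<notin> R" "S = insert s R"
      using True S remove_states by (auto simp: R_def)
    have b: "before (insert s X) s = before X s" for X
      by (auto simp: before_def precedes_def)
    have d: "insert s (shift a ` R) - {s} = shift a ` R" "insert s R - {s} = R"
      using shift_mem_iff[of a s R] sh R(2) by auto
    have "(-1 :: complex) ^ (card (unpaired a (insert s R)) + card (before (shift a ` R) s)) =
        - ((-1) ^ (card (unpaired a R) + card (before R s)))"
      using sign_other[OF R(1) a R(2) s] by (auto simp: minus_one_power_iff split: if_splits)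
    then show ?thesis
      using mem sh unfolding R(3)
      by (simp add: contract_single translate_single b d single_uminus power_add ac_simps)
  qed (simp add: contract_single translate_single mem)
qed (simp_all add: contract_add)

lemma wedge_translate_same:
  assumes v: "v \<in> Fock n" and a: "a < n" and s: "snd s = a"
  shows "wedge (shift a s) (translate a v) = translate a (wedge s v)"
proof (rule linear_eqI[OF v])
  fix S c assume S: "S \<in> states n"
  show "wedge (shift a s) (translate a (Poly_Mapping.single S c)) =
      translate a (wedge s (Poly_Mapping.single S c))"
  proof (cases "s \<in> S")
    case False
    show ?thesis
      using sign_same[OF S a False s] False
      by (simp add: wedge_single translate_single mult.assoc power_add ac_simps)
  qed (simp add: wedge_single translate_single)
qed (simp_all add: wedge_add)

lemma contract_translate_same:
  assumes v: "v \<in> Fock n" and a: "a < n" and s: "snd s = a"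
  shows "contract (shift a s) (translate a v) = translate a (contract s v)"
proof (rule linear_eqI[OF v])
  fix S c assume S: "S \<in> states n"
  show "contract (shift a s) (translate a (Poly_Mapping.single S c)) =
      translate a (contract s (Poly_Mapping.single S c))"
  proof (cases "s \<in> S")
    case True
    define R where "R = S - {s}"
    have R: "R \<in> states n" "s \<notin> R" "S = insert s R"
      using True S remove_states by (auto simp: R_def)
    have b: "before (insert t X) t = before X t" for t X
      by (auto simp: before_def precedes_def)
    have d: "insert (shift a s) (shift a ` R) - {shift a s} = shift a ` R" "insert s R - {s} = R"
      using shift_mem_iff[of a s R] R(2) by auto
    have "(-1 :: complex) ^ (card (unpaired a (insert s R)) + card (before (shift a ` R) (shift a s))) =
        (-1) ^ (card (unpaired a R) + card (before R s))"
      using sign_same[OF R(1) a R(2) s] by (auto simp: minus_one_power_iff split: if_splits)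
    then show ?thesis
      unfolding R(3) by (simp add: contract_single translate_single b d power_add ac_simps)
  qed (simp add: contract_single translate_single)
qed (simp_all add: contract_add)

lemma before_vac: "before (vac n) (-1, a) = {}"
  by (auto simp: before_def vac_def precedes_def)

lemma unpaired_vac: "a < n \<Longrightarrow> unpaired a (vac n) = {}"
  by (auto simp: unpaired_def vac_def partner_def)

lemma shift_vac: "a < n \<Longrightarrow> shift a ` vac n = insert (-1, a) (vac n)"
proof -
  assume a: "a < n"
  have "x \<in> shift a ` vac n" if "x \<in> insert (-1, a) (vac n)" for x
    using that a by (intro image_eqI[of _ _ "unshift a x"] shift_unshift(1)[symmetric])
      (auto simp: unshift_def vac_def)
  then show ?thesis using a by (auto simp: vac_def shift_def split: if_splits)
qed

lemma translate_v0: "a < n \<Longrightarrow> translate a (v0 n) = psi_plus a (-1) (v0 n)"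
  by (simp add: v0_def translate_single unpaired_vac shift_vac psi_plus_def wedge_single before_vac)
     (simp add: vac_def)

lemma translate_contract_v0:
  assumes a: "a < n" shows "translate a (psi_minus a (-1) (v0 n)) = v0 n"
proof -
  have "translate a (psi_minus a (-1) (v0 n)) = contract (shift a (0, a)) (translate a (v0 n))"
    unfolding psi_minus_def using a
    by (subst contract_translate_same) (auto simp: v0_def intro: Fock_single vac_states)
  also have "\<dots> = contract (-1, a) (wedge (-1, a) (v0 n))"
    by (simp add: translate_v0[OF a] psi_plus_def shift_def)
  also have "\<dots> = v0 n"
  proof -
    have n: "(-1, a) \<notin> vac n" by (simp add: vac_def)
    have "before (insert (-1, a) (vac n)) (-1, a) = {}"
      by (auto simp: before_def vac_def precedes_def)
    with n show ?thesis by (simp add: v0_def wedge_single contract_single before_vac)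
  qed
  finally show ?thesis .
qed

lemma wedge_wedge_v0:
  assumes "a < b"
  shows "wedge (-1, a) (wedge (-1, b) (v0 n)) = - wedge (-1, b) (wedge (-1, a) (v0 n))"
proof -
  have 1: "before (insert (-1, b) (vac n)) (-1, a) = {}"
    "before (insert (-1, a) (vac n)) (-1, b) = {(-1, a)}"
    using assms by (auto simp: before_def vac_def precedes_def)
  have 2: "(-1, a) \<notin> vac n" "(-1, b) \<notin> vac n" by (auto simp: vac_def)
  show ?thesis using assms 2
    by (simp add: v0_def wedge_single before_vac 1 single_uminus insert_commute)
qed

lemma translate_translate:
  assumes a: "a < n" and b: "b < n" and ab: "a \<noteq> b" and v: "v \<in> Fock n"
  shows "translate a (translate b v) = - translate b (translate a v)"
proof (rule linear_eqI[OF v])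
  fix S c assume S: "S \<in> states n"
  let ?P = "\<lambda>v. translate a (translate b v) = - translate b (translate a v)"
  have smul: "?P (smul c v)" if "?P v" for c v
    using that by simp
  have wed: "?P (wedge s v)" if "?P v" "v \<in> Fock n" "snd s < n" for s v
  proof -
    have *: "translate c (wedge s w) =
        (if snd s = c then wedge (shift c s) (translate c w) else - wedge s (translate c w))"
      if "w \<in> Fock n" "c < n" for c s w
      using wedge_translate_same[OF that] wedge_translate_other[OF that] by auto
    have sh: "shift c s = s" if "snd s \<noteq> c" for c s using that by (simp add: shift_def)
    show ?thesis using that a b ab
      by (auto simp: * Fock_translate wedge_uminus)
  qed
  have con: "?P (contract s v)" if "?P v" "v \<in> Fock n" for s v
  proof -
    have *: "translate c (contract s w) =
        (if snd s = c then contract (shift c s) (translate c w) else - contract s (translate c w))"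
      if "w \<in> Fock n" "c < n" for c s w
      using contract_translate_same[OF that] contract_translate_other[OF that] by auto
    show ?thesis using that a b ab
      by (auto simp: * Fock_translate contract_uminus)
  qed
  have "?P (Poly_Mapping.single S 1)"
    using S
  proof (induction S rule: states_induct)
    case vac
    have v0: "v0 n \<in> Fock n" by (simp add: v0_def Fock_single vac_states)
    have "wedge (-1, a) (wedge (-1, b) (v0 n)) = - wedge (-1, b) (wedge (-1, a) (v0 n))"
      using ab wedge_wedge_v0[of a b n] wedge_wedge_v0[of b a n] by (cases "a < b") auto
    moreover have "translate a (translate b (v0 n)) = - wedge (-1, b) (wedge (-1, a) (v0 n))"
      using wedge_translate_other[OF v0 a, of "(-1, b)"] ab
      by (simp add: translate_v0 a b psi_plus_def)
    moreover have "translate b (translate a (v0 n)) = - wedge (-1, a) (wedge (-1, b) (v0 n))"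
      using wedge_translate_other[OF v0 b, of "(-1, a)"] ab
      by (simp add: translate_v0 a b psi_plus_def)
    ultimately have "?P (v0 n)" by simp
    then show ?case by (simp add: v0_def)
  next
    case (insert S s)
    have "?P (smul ((-1) ^ card (before S s)) (wedge s (Poly_Mapping.single S 1)))"
      using insert by (intro smul wed Fock_single)
    then show ?case using insert by (simp add: wedge_single flip: power_add)
  next
    case (remove S s)
    have "?P (smul ((-1) ^ card (before S s)) (contract s (Poly_Mapping.single S 1)))"
      using remove by (intro smul con Fock_single)
    then show ?case using remove by (simp add: contract_single flip: power_add)
  qed
  from smul[OF this, of c] show "?P (Poly_Mapping.single S c)" by simp
qed simp_all

lemma translation_ops_translate: "translation_ops n translate"
proof -
  have v0: "v0 n \<in> Fock n" by (simp add: v0_def Fock_single vac_states)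
  have inv: "inv_into (Fock n) (translate a) (v0 n) = psi_minus a (-1) (v0 n)" if "a < n" for a
    using bij_translate[OF that] translate_contract_v0[OF that] Fock_contract[OF v0]
    by (intro inv_into_f_eq) (auto simp: bij_betw_def psi_minus_def)
  have plus: "psi_plus a k (translate a v) = translate a (psi_plus a (k + 1) v)"
    if "a < n" "v \<in> Fock n" for a k v
    using wedge_translate_same[OF that(2,1), of "(k + 1, a)"] by (simp add: psi_plus_def shift_def)
  have minus: "psi_minus a k (translate a v) = translate a (psi_minus a (k - 1) v)"
    if "a < n" "v \<in> Fock n" for a k v
    using contract_translate_same[OF that(2,1), of "(- (k - 1) - 1, a)"]
    by (simp add: psi_minus_def shift_def)
  have plus': "psi_plus a k (translate b v) = - translate b (psi_plus a k v)"
    if "b < n" "v \<in> Fock n" "a \<noteq> b" for a b k v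
    using wedge_translate_other[OF that(2,1), of "(k, a)"] that(3) by (simp add: psi_plus_def)
  have minus': "psi_minus a k (translate b v) = - translate b (psi_minus a k v)"
    if "b < n" "v \<in> Fock n" "a \<noteq> b" for a b k v
    using contract_translate_other[OF that(2,1), of "(- k - 1, a)"] that(3)
    by (simp add: psi_minus_def)
  show ?thesis
    unfolding translation_ops_def
    by (intro conjI allI impI ballI bij_translate translate_v0 inv plus minus plus' minus'
        translate_translate translate_linear) (assumption | simp)+
qed

end

theory Submission
  imports Defs
begin

text \<open>The Casimir element $\Omega = \sum_s s \wedge {} \otimes i(s)$ commutes with the diagonal action
  of $\mathfrak{gl}_\infty$, hence with $g \otimes g$. Since $\delta_J \ge 0$, it annihilates
  $Q^{-\beta} v_0 \otimes Q^{-\beta - \delta_J} v_0$, therefore also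
  $g Q^{-\beta} v_0 \otimes g Q^{-\beta - \delta_J} v_0$. Pairing the result with
  $Q^{-\beta} Q^{\delta_b - \mathbf{k}} v_0 \otimes Q^{-\beta - \delta_J} Q^{-\mathbf{k} - \rho - \delta_c} v_0$
  leaves exactly one term of $\Omega$ for each index in $I \cup \{b, c\}$, and these terms are the
  products of $\tau$-functions in the theorem. For the specialisations, the exponentials are
  multiplicity-free in the variables, so that only finitely many monomials survive when
  all but finitely many variables vanish.\<close>

section \<open>Pairing\<close>

text \<open>The counting rests on one picture: in Q^gamma v_0 the component a is filled exactly from
  level -gamma_a upward. A term of the Casimir element survives only at a site that the first test
  vector contains and the second one lacks. After the shifts by beta and beta + delta_J there are
  gamma_a - gamma'_a + (delta_J)_a such levels in component a. For gamma = delta_b - k and gamma' =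
  -k - rho - delta_c these numbers are the coordinates of delta_b + delta_c + delta_I, so that b, c
  distinct and outside I make each of them 0 or 1. The obstacle is that the Casimir element is an
  infinite sum and g exists only as a power series. Invariance is therefore proved for one
  coefficient at a time, by induction on the size of the monomial. Removing a variable from the
  monomial transfers a matrix unit to the test vectors, which is why the invariance statements are
  about arbitrary test vectors \<open>u\<close> and \<open>w\<close>.\<close>

lemma pairing_superset:
  assumes "finite A" "Poly_Mapping.keys u \<subseteq> A"
  shows "pairing u v = (\<Sum>S\<in>A. Poly_Mapping.lookup u S * Poly_Mapping.lookup v S)"
  unfolding pairing_def using assms by (intro sum.mono_neutral_left) (auto simp: in_keys_iff)

lemma pairing_add_left: "pairing (u + u') v = pairing u v + pairing u' v"
proof -
  let ?A = "Poly_Mapping.keys u \<union> Poly_Mapping.keys u'"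
  have "Poly_Mapping.keys (u + u') \<subseteq> ?A" by (rule Poly_Mapping.keys_add)
  then show ?thesis
    by (simp add: pairing_superset[of ?A] lookup_add sum.distrib distrib_right)
qed

lemma pairing_add_right: "pairing u (v + v') = pairing u v + pairing u v'"
  by (simp add: pairing_def lookup_add distrib_left sum.distrib)

lemma pairing_zero [simp]: "pairing 0 v = 0" "pairing u 0 = 0"
  by (simp_all add: pairing_def)

lemma pairing_smul_right: "pairing u (smul c v) = c * pairing u v"
  by (simp add: pairing_def sum_distrib_left ac_simps)

lemma pairing_uminus_left: "pairing (- u) v = - pairing u v"
  using pairing_add_left[of u "- u" v] by (simp add: eq_neg_iff_add_eq_0 add.commute)

lemma pairing_sum_right: "pairing u (\<Sum>i\<in>A. h i) = (\<Sum>i\<in>A. pairing u (h i))"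
  by (induction A rule: infinite_finite_induct) (auto simp: pairing_add_right)

lemma bilinear_eqI:
  fixes A B :: "fock \<Rightarrow> fock \<Rightarrow> complex"
  assumes A: "\<And>u u' v. A (u + u') v = A u v + A u' v" "\<And>u v v'. A u (v + v') = A u v + A u v'"
    and B: "\<And>u u' v. B (u + u') v = B u v + B u' v" "\<And>u v v'. B u (v + v') = B u v + B u v'"
    and eq: "\<And>S c T d. A (Poly_Mapping.single S c) (Poly_Mapping.single T d) =
      B (Poly_Mapping.single S c) (Poly_Mapping.single T d)"
  shows "A u v = B u v"
proof -
  have *: "F (\<Sum>i\<in>X. h i) = (\<Sum>i\<in>X. F (h i))"
    if "\<And>x y. F (x + y) = F x + F y" for F :: "fock \<Rightarrow> complex" and X and h :: "site set \<Rightarrow> fock"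
  proof -
    have "F 0 = 0" using that[of 0 0] by simp
    then show ?thesis by (induction X rule: infinite_finite_induct) (auto simp: that)
  qed
  have 1: "A (Poly_Mapping.single S c) v = B (Poly_Mapping.single S c) v" for S c
    by (subst (1 2) fock_expand[of v]) (simp add: * A(2) B(2) eq)
  show ?thesis
    by (subst (1 2) fock_expand[of u]) (simp add: *[of "\<lambda>u. A u v"] *[of "\<lambda>u. B u v"] A(1) B(1) 1)
qed

lemma pairing_single:
  "pairing (Poly_Mapping.single S c) (Poly_Mapping.single T d) = (if S = T then c * d else 0)"
  by (simp add: pairing_superset[of "{S}"] lookup_single when_def)

lemma before_insert_self: "before (insert s S) s = before S s"
  by (auto simp: before_def precedes_def)

lemma before_remove_self: "before (S - {s}) s = before S s"
  by (auto simp: before_def precedes_def)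

text \<open>Both operators take their sign from the factors before \<open>s\<close>, and these are
  the same whether or not \<open>s\<close> itself is present.\<close>

lemma pairing_wedge: "pairing u (wedge s v) = pairing (contract s u) v"
proof (rule bilinear_eqI[of "\<lambda>u v. pairing u (wedge s v)" "\<lambda>u v. pairing (contract s u) v"])
  fix S c T d
  have "s \<notin> T \<and> S = insert s T \<longleftrightarrow> s \<in> S \<and> S - {s} = T" by auto
  then show "pairing (Poly_Mapping.single S c) (wedge s (Poly_Mapping.single T d)) =
      pairing (contract s (Poly_Mapping.single S c)) (Poly_Mapping.single T d)"
    by (auto simp: wedge_single contract_single pairing_single before_remove_self before_insert_self)
qed (simp_all add: pairing_add_left pairing_add_right wedge_add contract_add)

lemma pairing_commute: "pairing u v = pairing v u"
  by (rule bilinear_eqI) (auto simp: pairing_add_left pairing_add_right pairing_single)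

lemma pairing_contract: "pairing u (contract s v) = pairing (wedge s u) v"
  by (metis pairing_commute pairing_wedge)


section \<open>Canonical anticommutation relations\<close>

lemma wedge_smul: "wedge s (smul c v) = smul c (wedge s v)"
  and contract_smul: "contract s (smul c v) = smul c (contract s v)"
  by (simp_all add: wedge_def contract_def lin_ext_smul)

lemma precedes_flip: "s \<noteq> t \<Longrightarrow> precedes s t \<longleftrightarrow> \<not> precedes t s"
  by (cases s; cases t) (auto simp: precedes_def)

lemma card_before_insert:
  assumes "S \<in> states n" "t \<notin> S"
  shows "card (before (insert t S) s) = card (before S s) + (if precedes t s then 1 else 0)"
proof -
  have "before (insert t S) s = (if precedes t s then insert t (before S s) else before S s)"
    by (auto simp: before_def)
  moreover have "t \<notin> before S s" using assms by (simp add: before_def)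
  ultimately show ?thesis using finite_before[OF assms(1)] by simp
qed

text \<open>Exactly one of the two sites precedes the other, so exactly one of the two orders of
  insertion meets an additional factor.\<close>

lemma sign_swap:
  assumes "S \<in> states n" "s \<notin> S" "t \<notin> S" "s \<noteq> t"
  shows "c * (-1 :: complex) ^ card (before S t) * (-1) ^ card (before (insert t S) s) =
    - (c * (-1) ^ card (before S s) * (-1) ^ card (before (insert s S) t))"
  using assms precedes_flip[of s t] by (simp add: card_before_insert)

lemma wedge_wedge:
  assumes "v \<in> Fock n"
  shows "wedge s (wedge t v) = - wedge t (wedge s v)"
proof (rule linear_eqI[OF assms])
  fix S c assume S: "S \<in> states n"
  show "wedge s (wedge t (Poly_Mapping.single S c)) = - wedge t (wedge s (Poly_Mapping.single S c))"
  proof (cases "s \<in> S \<or> t \<in> S \<or> s = t")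
    case False
    then have "wedge s (wedge t (Poly_Mapping.single S c)) = Poly_Mapping.single (insert s (insert t S))
        (c * (-1) ^ card (before S t) * (-1) ^ card (before (insert t S) s))"
      "wedge t (wedge s (Poly_Mapping.single S c)) = Poly_Mapping.single (insert s (insert t S))
        (c * (-1) ^ card (before S s) * (-1) ^ card (before (insert s S) t))"
      by (auto simp: wedge_single insert_commute)
    then show ?thesis using False by (simp add: sign_swap[OF S, of s t] single_uminus)
  qed (auto simp: wedge_single)
qed (simp_all add: wedge_add)

lemma contract_wedge:
  assumes "v \<in> Fock n"
  shows "contract s (wedge t v) = (if s = t then v else 0) - wedge t (contract s v)"
proof (rule linear_eqI[OF assms])
  fix S c assume S: "S \<in> states n"
  show "contract s (wedge t (Poly_Mapping.single S c)) =
    (if s = t then Poly_Mapping.single S c else 0) - wedge t (contract s (Poly_Mapping.single S c))"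
  proof (cases "s = t")
    case True
    have "insert t S - {t} = S" if "t \<notin> S" using that by auto
    then show ?thesis using True
      by (auto simp: wedge_single contract_single before_insert_self before_remove_self insert_absorb mult.assoc
          simp flip: power_add)
  next
    case ne: False
    show ?thesis
    proof (cases "s \<in> S \<and> t \<notin> S")
      case True
      define R where "R = S - {s}"
      have R: "R \<in> states n" "s \<notin> R" "S = insert s R" "t \<notin> R"
        using True S remove_states by (auto simp: R_def)
      have d: "insert t (insert s R) - {s} = insert t R" "insert s R - {s} = R" using R ne by auto
      have "contract s (wedge t (Poly_Mapping.single S c)) = Poly_Mapping.single (insert t R)
          (c * (-1) ^ card (before (insert s R) t) * (-1) ^ card (before (insert t R) s))"
        using ne R d by (simp add: wedge_single contract_single insert_commute[of t s] before_insert_self)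
      moreover have "wedge t (contract s (Poly_Mapping.single S c)) = Poly_Mapping.single (insert t R)
          (c * (-1) ^ card (before R s) * (-1) ^ card (before R t))"
        using ne R d by (simp add: wedge_single contract_single before_insert_self)
      moreover have "c * (-1) ^ card (before (insert s R) t) * (-1) ^ card (before (insert t R) s) =
          - (c * (-1) ^ card (before R s) * (-1) ^ card (before R t))"
        using card_before_insert[OF R(1), of s t] card_before_insert[OF R(1), of t s] R
          precedes_flip[OF ne] by simp
      ultimately show ?thesis using ne by (simp add: single_uminus)
    qed (use ne in \<open>auto simp: wedge_single contract_single\<close>)
  qed
qed (auto simp: wedge_add contract_add)

lemma contract_contract:
  assumes "v \<in> Fock n"
  shows "contract s (contract t v) = - contract t (contract s v)"
proof (rule linear_eqI[OF assms])
  fix S c assume S: "S \<in> states n"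
  show "contract s (contract t (Poly_Mapping.single S c)) = - contract t (contract s (Poly_Mapping.single S c))"
  proof (cases "s \<in> S \<and> t \<in> S \<and> s \<noteq> t")
    case True
    define R where "R = S - {s, t}"
    have "R \<in> states n" using remove_states[OF remove_states[OF S], of s t]
      by (simp add: R_def Diff_insert2[symmetric] insert_commute)
    then have R: "R \<in> states n" "s \<notin> R" "S = insert s (insert t R)" "t \<notin> R"
      using True by (auto simp: R_def)
    have d: "insert s (insert t R) - {s} = insert t R" "insert t R - {t} = R"
      "insert s (insert t R) - {t} = insert s R" "insert s R - {s} = R" using R True by auto
    have b: "before (insert s (insert t R)) s = before (insert t R) s"
       "before (insert s (insert t R)) t = before (insert s R) t"
       "before (insert s R) s = before R s" "before (insert t R) t = before R t"
      by (auto simp: before_def precedes_def)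
    have "contract s (contract t (Poly_Mapping.single S c)) = Poly_Mapping.single R
        (c * (-1) ^ card (before (insert s R) t) * (-1) ^ card (before R s))"
      "contract t (contract s (Poly_Mapping.single S c)) = Poly_Mapping.single R
        (c * (-1) ^ card (before (insert t R) s) * (-1) ^ card (before R t))"
      using R True by (simp_all add: contract_single d b)
    moreover have "c * (-1) ^ card (before (insert s R) t) * (-1) ^ card (before R s) =
        - (c * (-1) ^ card (before (insert t R) s) * (-1) ^ card (before R t))"
      using sign_swap[OF R(1) R(2,4), of c] True by (simp add: ac_simps)
    ultimately show ?thesis by (simp add: single_uminus)
  qed (auto simp: contract_single)
qed (simp_all add: contract_add)


section \<open>Translation operators\<close>

lemma sign_pow_0 [simp]: "sign_pow 0 = 1"
  by (simp add: sign_pow_def)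

lemma sign_pow_add: "sign_pow (e + f) = sign_pow e * sign_pow f"
  by (auto simp: sign_pow_def)

lemma sign_pow_cong: "even (e - f) \<Longrightarrow> sign_pow e = sign_pow f"
  by (auto simp: sign_pow_def)

text \<open>\<open>translate a\<close> permutes the monomials up to sign, so each coefficient of the
  image has a single source. Isometry follows because the signs square to 1.\<close>

lemma lookup_translate:
  "Poly_Mapping.lookup (translate a v) (shift a ` S) = (-1) ^ card (unpaired a S) * Poly_Mapping.lookup v S"
proof -
  have inj: "shift a ` T = shift a ` S \<longleftrightarrow> T = S" for T
    by (metis shift_image(2))
  have "Poly_Mapping.lookup (translate a v) (shift a ` S) =
      (\<Sum>T\<in>Poly_Mapping.keys v. if T = S then Poly_Mapping.lookup v S * (-1) ^ card (unpaired a S) else 0)"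
    unfolding translate_def lin_ext_def
    by (auto simp: lookup_sum lookup_single when_def inj intro!: sum.cong)
  then show ?thesis by (simp add: in_keys_iff)
qed

lemma pairing_translate: "pairing (translate a u) (translate a v) = pairing u v"
proof -
  have keys: "Poly_Mapping.keys (translate a u) \<subseteq> (`) (shift a) ` Poly_Mapping.keys u"
  proof
    fix T assume T: "T \<in> Poly_Mapping.keys (translate a u)"
    have "T = shift a ` (unshift a ` T)" by simp
    then show "T \<in> (`) (shift a) ` Poly_Mapping.keys u"
      using T lookup_translate[of a u "unshift a ` T"] by (intro image_eqI) (auto simp: in_keys_iff)
  qed
  have inj: "inj_on ((`) (shift a)) X" for X
    by (metis inj_onI shift_image(2))
  have sq: "(-1 :: complex) ^ k * x * ((-1) ^ k * y) = x * y" for k x y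
    by (cases "even k") auto
  have "pairing (translate a u) (translate a v) =
     (\<Sum>S\<in>Poly_Mapping.keys u. Poly_Mapping.lookup u S * Poly_Mapping.lookup v S)"
    by (simp add: pairing_superset[OF _ keys] sum.reindex[OF inj] lookup_translate sq)
  then show ?thesis by (simp add: pairing_def)
qed

text \<open>\<open>translation_ops\<close> fixes the operators only on \<open>Fock n\<close> and for
  indices below \<open>n\<close>; elsewhere \<open>Q\<close> is arbitrary. Hence the membership
  conditions throughout the locale.\<close>

locale translation =
  fixes n :: nat and Q :: "nat \<Rightarrow> fock \<Rightarrow> fock"
  assumes ops: "translation_ops n Q"
begin

text \<open>Contraction is indexed here by its site and not by its mode:
  \<open>psi_minus a k\<close> contracts at level -k - 1. The factors z and z^(-1) then become the
  same shift of level by +1, so wedging and contraction can be treated together.\<close>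

lemma
  assumes a: "a < n"
  shows bij_Q: "bij_betw (Q a) (Fock n) (Fock n)"
    and Q_add: "u \<in> Fock n \<Longrightarrow> v \<in> Fock n \<Longrightarrow> Q a (u + v) = Q a u + Q a v"
    and Q_smul: "v \<in> Fock n \<Longrightarrow> Q a (smul c v) = smul c (Q a v)"
    and Q_v0: "Q a (v0 n) = wedge (-1, a) (v0 n)"
    and inv_Q_v0: "inv_into (Fock n) (Q a) (v0 n) = contract (0, a) (v0 n)"
    and wedge_Q_same: "v \<in> Fock n \<Longrightarrow> wedge (k, a) (Q a v) = Q a (wedge (k + 1, a) v)"
    and contract_Q_same: "v \<in> Fock n \<Longrightarrow> contract (k, a) (Q a v) = Q a (contract (k + 1, a) v)"
proof -
  have *: "bij_betw (Q a) (Fock n) (Fock n)"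
    "\<forall>u\<in>Fock n. \<forall>v\<in>Fock n. Q a (u + v) = Q a u + Q a v"
    "\<forall>c. \<forall>v\<in>Fock n. Q a (smul c v) = smul c (Q a v)"
    "Q a (v0 n) = psi_plus a (-1) (v0 n)"
    "inv_into (Fock n) (Q a) (v0 n) = psi_minus a (-1) (v0 n)"
    "\<forall>k. \<forall>v\<in>Fock n. psi_plus a k (Q a v) = Q a (psi_plus a (k + 1) v)"
    "\<forall>k. \<forall>v\<in>Fock n. psi_minus a k (Q a v) = Q a (psi_minus a (k - 1) v)"
    using ops a unfolding translation_ops_def by blast+
  show "bij_betw (Q a) (Fock n) (Fock n)" by (rule *)
  show "Q a (v0 n) = wedge (-1, a) (v0 n)" using *(4) by (simp add: psi_plus_def)
  show "inv_into (Fock n) (Q a) (v0 n) = contract (0, a) (v0 n)" using *(5) by (simp add: psi_minus_def)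
  show "u \<in> Fock n \<Longrightarrow> v \<in> Fock n \<Longrightarrow> Q a (u + v) = Q a u + Q a v" using *(2) by blast
  show "v \<in> Fock n \<Longrightarrow> Q a (smul c v) = smul c (Q a v)" using *(3) by blast
  show "v \<in> Fock n \<Longrightarrow> wedge (k, a) (Q a v) = Q a (wedge (k + 1, a) v)"
    using *(6) unfolding psi_plus_def by blast
  show "contract (k, a) (Q a v) = Q a (contract (k + 1, a) v)" if "v \<in> Fock n"
    using *(7)[rule_format, OF that, of "- k - 1"] by (simp add: psi_minus_def add.commute)
qed

lemma
  assumes a: "a < n" "b < n" "a \<noteq> b" and v: "v \<in> Fock n"
  shows wedge_Q_other: "wedge (k, a) (Q b v) = - Q b (wedge (k, a) v)"
    and contract_Q_other: "contract (k, a) (Q b v) = - Q b (contract (k, a) v)"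
    and Q_Q: "Q a (Q b v) = - Q b (Q a v)"
proof -
  have *: "\<forall>k. psi_plus a k (Q b v) = - Q b (psi_plus a k v)"
    "\<forall>k. psi_minus a k (Q b v) = - Q b (psi_minus a k v)"
    "Q a (Q b v) = - Q b (Q a v)"
    using conjunct2[OF iffD1[OF translation_ops_def ops], rule_format, OF a] v by blast+
  show "wedge (k, a) (Q b v) = - Q b (wedge (k, a) v)" using *(1) by (simp add: psi_plus_def)
  show "contract (k, a) (Q b v) = - Q b (contract (k, a) v)"
    using *(2)[rule_format, of "- k - 1"] by (simp add: psi_minus_def)
  show "Q a (Q b v) = - Q b (Q a v)" by (rule *)
qed

lemma Q_Fock: "a < n \<Longrightarrow> v \<in> Fock n \<Longrightarrow> Q a v \<in> Fock n"
  using bij_Q by (auto simp: bij_betw_def)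

lemma v0_Fock: "v0 n \<in> Fock n"
  by (simp add: v0_def Fock_single vac_states)

text \<open>The translation operators are unique on \<open>Fock n\<close>, hence isometric.\<close>

lemma Q_eq_translate:
  assumes a: "a < n" and v: "v \<in> Fock n" shows "Q a v = translate a v"
proof -
  have zero: "Q a 0 = 0" using Q_add[OF a Fock_zero Fock_zero] by simp
  have single: "Q a (Poly_Mapping.single S 1) = translate a (Poly_Mapping.single S 1)" if "S \<in> states n" for S
    using that
  proof (induction S rule: states_induct)
    case vac
    then show ?case using a by (simp add: Q_v0 translate_v0 psi_plus_def flip: v0_def)
  next
    case (insert S s)
    let ?v = "Poly_Mapping.single S 1 :: fock"
    have v: "?v \<in> Fock n" using insert by (simp add: Fock_single)
    have "Q a (wedge s ?v) = translate a (wedge s ?v)"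
    proof (cases "snd s = a")
      case True
      have "Q a (wedge s ?v) = wedge (shift a s) (Q a ?v)"
        using wedge_Q_same[OF a v, of "fst s - 1"] True by (cases s) (simp add: shift_def)
      then show ?thesis using wedge_translate_same[OF v a True] insert.IH by simp
    next
      case False
      have "Q a (wedge s ?v) = - wedge s (Q a ?v)"
        using wedge_Q_other[OF _ a _ v, of "snd s" "fst s"] False insert by simp
      then show ?thesis using wedge_translate_other[OF v a False] insert.IH by simp
    qed
    moreover have "Poly_Mapping.single (Set.insert s S) 1 = smul ((-1) ^ card (before S s)) (wedge s ?v)"
      using insert by (simp add: wedge_single flip: power_add)
    ultimately show ?case using insert v by (simp add: Q_smul[OF a] Fock_wedge)
  next
    case (remove S s)
    let ?v = "Poly_Mapping.single S 1 :: fock"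
    have v: "?v \<in> Fock n" using remove by (simp add: Fock_single)
    have s: "snd s < n" using remove states_snd by blast
    have "Q a (contract s ?v) = translate a (contract s ?v)"
    proof (cases "snd s = a")
      case True
      have "Q a (contract s ?v) = contract (shift a s) (Q a ?v)"
        using contract_Q_same[OF a v, of "fst s - 1"] True by (cases s) (simp add: shift_def)
      then show ?thesis using contract_translate_same[OF v a True] remove.IH by simp
    next
      case False
      have "Q a (contract s ?v) = - contract s (Q a ?v)"
        using contract_Q_other[OF s a _ v, of "fst s"] False by simp
      then show ?thesis using contract_translate_other[OF v a False] remove.IH by simp
    qed
    moreover have "Poly_Mapping.single (S - {s}) 1 = smul ((-1) ^ card (before S s)) (contract s ?v)"
      using remove by (simp add: contract_single flip: power_add)
    ultimately show ?case using v by (simp add: Q_smul[OF a] Fock_contract)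
  qed
  \<comment> \<open>\<open>linear_eqI\<close> asks for additivity on the whole type, whereas
    \<open>Q a\<close> is additive only on \<open>Fock n\<close>. The sum is therefore built up
    inside \<open>Fock n\<close>.\<close>
  have "Q a (\<Sum>S\<in>X. smul (c S) (Poly_Mapping.single S 1)) =
      translate a (\<Sum>S\<in>X. smul (c S) (Poly_Mapping.single S 1))"
    if "finite X" "X \<subseteq> states n" for X and c :: "site set \<Rightarrow> complex"
    using that
  proof (induction X rule: finite_induct)
    case (insert S X)
    have "(\<Sum>S\<in>X. smul (c S) (Poly_Mapping.single S 1)) \<in> Fock n"
      using insert by (intro Fock_sum Fock_smul Fock_single) auto
    then have "Q a (smul (c S) (Poly_Mapping.single S 1) + (\<Sum>S\<in>X. smul (c S) (Poly_Mapping.single S 1))) =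
        smul (c S) (Q a (Poly_Mapping.single S 1)) + Q a (\<Sum>S\<in>X. smul (c S) (Poly_Mapping.single S 1))"
      using insert.prems by (subst Q_add[OF a]) (auto simp: Q_smul[OF a] Fock_single intro!: Fock_smul simp del: smul_simps(8))
    then show ?case using insert single by (simp del: smul_simps(8))
  qed (simp add: zero)
  from this[of "Poly_Mapping.keys v" "Poly_Mapping.lookup v"] show ?thesis
    using v fock_expand[of v] by (simp add: Fock_def)
qed

lemma pairing_Q: "a < n \<Longrightarrow> u \<in> Fock n \<Longrightarrow> v \<in> Fock n \<Longrightarrow> pairing (Q a u) (Q a v) = pairing u v"
  by (simp add: Q_eq_translate pairing_translate)

abbreviation Qi where "Qi a \<equiv> inv_into (Fock n) (Q a)"

lemma Qi_Fock: "a < n \<Longrightarrow> v \<in> Fock n \<Longrightarrow> Qi a v \<in> Fock n"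
  using bij_betw_imp_surj_on[OF bij_Q] by (metis inv_into_into)

lemma Q_Qi: "a < n \<Longrightarrow> v \<in> Fock n \<Longrightarrow> Q a (Qi a v) = v"
  by (rule bij_betw_inv_into_right[OF bij_Q])

lemma Qi_Q: "a < n \<Longrightarrow> v \<in> Fock n \<Longrightarrow> Qi a (Q a v) = v"
  by (rule bij_betw_inv_into_left[OF bij_Q])

lemma Qi_unique: "a < n \<Longrightarrow> v \<in> Fock n \<Longrightarrow> Q a v = w \<Longrightarrow> Qi a w = v"
  using Qi_Q by blast

lemma Q_uminus: "a < n \<Longrightarrow> v \<in> Fock n \<Longrightarrow> Q a (- v) = - Q a v"
  by (simp add: Q_eq_translate Fock_def)

section \<open>Integer powers of a single translation operator\<close>

abbreviation Qp where "Qp \<equiv> Q_int_pow n Q"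

lemma Qp_Fock: "a < n \<Longrightarrow> v \<in> Fock n \<Longrightarrow> Qp a m v \<in> Fock n"
proof -
  assume a: "a < n" and v: "v \<in> Fock n"
  have "(Q a ^^ k) v \<in> Fock n" "(Qi a ^^ k) v \<in> Fock n" for k
    using a v by (induction k) (auto simp: Q_Fock Qi_Fock)
  then show ?thesis by (simp add: Q_int_pow_def)
qed

lemma Qp_0 [simp]: "Qp a 0 v = v"
  by (simp add: Q_int_pow_def)

lemma Qp_1: "Qp a 1 v = Q a v" and Qp_m1: "Qp a (-1) v = Qi a v"
  by (simp_all add: Q_int_pow_def)

lemma Qp_succ:
  assumes a: "a < n" and v: "v \<in> Fock n" shows "Qp a (m + 1) v = Q a (Qp a m v)"
proof (cases "0 \<le> m")
  case True
  then show ?thesis by (simp add: Q_int_pow_def nat_add_distrib)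
next
  case False
  \<comment> \<open>For negative \<open>m\<close> one factor of the inverse is split off, for the
    additional \<open>Q a\<close> to cancel.\<close>
  define k where "k = nat (- m - 1)"
  have k: "nat (- m) = Suc k" "nat (- (m + 1)) = k" using False by (auto simp: k_def)
  have "(Qi a ^^ k) v \<in> Fock n" using a v by (induction k) (auto simp: Qi_Fock)
  then show ?thesis using False k a by (auto simp: Q_int_pow_def Q_Qi)
qed

lemma Qp_pred:
  assumes "a < n" "v \<in> Fock n" shows "Qp a (m - 1) v = Qi a (Qp a m v)"
  using Qp_succ[OF assms, of "m - 1"] Qi_Q[OF assms(1) Qp_Fock[OF assms, of "m - 1"]] by simp

lemma Qp_induct [case_names zero succ pred]:
  assumes "P 0" "\<And>m. P m \<Longrightarrow> P (m + 1)" "\<And>m. P m \<Longrightarrow> P (m - 1)" shows "P (m :: int)"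
  using assms by (rule int_induct[where k = 0])

lemma Qp_add:
  assumes a: "a < n" and v: "v \<in> Fock n" shows "Qp a l (Qp a m v) = Qp a (l + m) v"
proof (induction l rule: Qp_induct)
  case (succ l)
  then show ?case using Qp_succ[OF a v, of "l + m"] Qp_succ[OF a Qp_Fock[OF a v], of l m] by (simp add: ac_simps)
next
  case (pred l)
  then show ?case using Qp_pred[OF a v, of "l + m"] Qp_pred[OF a Qp_Fock[OF a v], of l m] by (simp add: algebra_simps)
qed simp

lemma Qp_smul:
  assumes a: "a < n" and v: "v \<in> Fock n" shows "Qp a m (smul c v) = smul c (Qp a m v)"
proof (induction m rule: Qp_induct)
  case (succ m)
  then show ?case using a v by (simp add: Qp_succ Q_smul Fock_smul Qp_Fock)
next
  case (pred m)
  have "Q a (smul c (Qi a (Qp a m v))) = smul c (Qp a m v)"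
    using a v by (simp add: Q_smul Qi_Fock Qp_Fock Q_Qi)
  then show ?case using a v pred by (simp add: Qp_pred Fock_smul Qi_Fock Qp_Fock Qi_unique)
qed simp

lemma pairing_Qp:
  assumes a: "a < n" and "u \<in> Fock n" "v \<in> Fock n" shows "pairing (Qp a m u) (Qp a m v) = pairing u v"
proof (induction m rule: Qp_induct)
  case (succ m)
  then show ?case using assms by (simp add: Qp_succ pairing_Q Qp_Fock)
next
  case (pred m)
  then show ?case using assms pairing_Q[OF a, of "Qi a (Qp a m u)" "Qi a (Qp a m v)"]
    by (simp add: Qp_pred Qi_Fock Qp_Fock Q_Qi)
qed simp

text \<open>Operators commuting with the \<open>Q b\<close> in the way \<open>wedge (k, a)\<close> and \<open>contract (k, a)\<close> do;
  constant families such as \<open>Q a\<close> and its inverse are also covered.\<close>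

definition intertwiner :: "nat \<Rightarrow> (int \<Rightarrow> fock \<Rightarrow> fock) \<Rightarrow> bool" where
  "intertwiner a f \<longleftrightarrow> (\<forall>k. \<forall>v\<in>Fock n. f k v \<in> Fock n) \<and>
     (\<forall>k. \<forall>v\<in>Fock n. f k (Q a v) = Q a (f (k + 1) v)) \<and>
     (\<forall>b<n. b \<noteq> a \<longrightarrow> (\<forall>k. \<forall>v\<in>Fock n. f k (Q b v) = - Q b (f k v)))"

lemma intertwiner_wedge: "a < n \<Longrightarrow> intertwiner a (\<lambda>k. wedge (k, a))"
  by (auto simp: intertwiner_def Fock_wedge wedge_Q_same wedge_Q_other)

lemma intertwiner_contract: "a < n \<Longrightarrow> intertwiner a (\<lambda>k. contract (k, a))"
  by (auto simp: intertwiner_def Fock_contract contract_Q_same contract_Q_other)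

lemma intertwiner_Q: "a < n \<Longrightarrow> intertwiner a (\<lambda>_. Q a)"
  unfolding intertwiner_def using Q_Fock Q_Q by blast

lemma intertwiner_Qi: assumes a: "a < n" shows "intertwiner a (\<lambda>_. Qi a)"
proof -
  have "Qi a (Q b v) = - Q b (Qi a v)" if b: "b < n" "b \<noteq> a" and v: "v \<in> Fock n" for b v
  proof (rule Qi_unique[OF a])
    have *: "- Q b (Qi a v) = smul (-1) (Q b (Qi a v))"
      by (rule poly_mapping_eqI) simp
    show "- Q b (Qi a v) \<in> Fock n"
      unfolding * using a b v by (intro Fock_smul Q_Fock Qi_Fock)
    show "Q a (- Q b (Qi a v)) = Q b v"
      using a b v by (simp add: Q_uminus Q_Q[of a b] Q_Fock Qi_Fock Q_Qi)
  qed
  then show ?thesis using a by (auto simp: intertwiner_def Qi_Fock Q_Qi Qi_Q)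
qed

lemma intertwiner_Qp:
  assumes f: "intertwiner a f" and a: "a < n" and b: "b < n" and v: "v \<in> Fock n"
  shows "f k (Qp b m v) = smul (sign_pow (if b = a then 0 else m)) (Qp b m (f (k + (if b = a then m else 0)) v))"
proof -
  have fF: "f k v \<in> Fock n" if "v \<in> Fock n" for k v using f that by (simp add: intertwiner_def)
  have um: "- x = smul (-1) x" for x :: fock by (rule poly_mapping_eqI) simp
  show ?thesis
  proof (cases "b = a")
    case True
    have fQ: "f k (Q a v) = Q a (f (k + 1) v)" if "v \<in> Fock n" for k v
      using f that by (simp add: intertwiner_def)
    have fQi: "f k (Qi a v) = Qi a (f (k - 1) v)" if "v \<in> Fock n" for k v
      using fQ[of "Qi a v" "k - 1"] that a by (simp add: Qi_Fock Q_Qi Qi_Q fF)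
    have "f k (Qp a m v) = Qp a m (f (k + m) v)" for k
    proof (induction m arbitrary: k rule: Qp_induct)
      case (succ m)
      have "k + 1 + m = k + (m + 1)" by simp
      then show ?case using a v succ[of "k + 1"] by (simp only: Qp_succ Qp_Fock fQ fF)
    next
      case (pred m)
      have "k - 1 + m = k + (m - 1)" by simp
      then show ?case using a v pred[of "k - 1"] by (simp only: Qp_pred Qp_Fock fQi fF)
    qed simp
    then show ?thesis using True by simp
  next
    case False
    have fQ: "f k (Q b v) = smul (-1) (Q b (f k v))" if "v \<in> Fock n" for v
      using f that b False by (simp add: intertwiner_def um)
    have fQi: "f k (Qi b v) = smul (-1) (Qi b (f k v))" if "v \<in> Fock n" for v
    proof -
      have "Q b (smul (-1) (f k (Qi b v))) = f k v"
        using fQ[of "Qi b v"] that b by (simp add: Qi_Fock Q_Qi Q_smul fF)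
      then have "Qi b (f k v) = smul (-1) (f k (Qi b v))"
        using that b by (intro Qi_unique) (auto intro!: Fock_smul fF Qi_Fock)
      then show ?thesis by simp
    qed
    have Qis: "Qi b (smul c w) = smul c (Qi b w)" if "w \<in> Fock n" for c w
      using Qp_smul[OF b that, of "-1" c] by (simp add: Qp_m1)
    have "f k (Qp b m v) = smul (sign_pow m) (Qp b m (f k v))"
    proof (induction m rule: Qp_induct)
      case (succ m)
      then show ?case using b v by (simp add: Qp_succ Qp_Fock fQ fF Q_smul sign_pow_add) (simp add: sign_pow_def)
    next
      case (pred m)
      then show ?case using b v
        by (simp add: Qp_pred Qp_Fock fQi fF Qis) (simp add: sign_pow_def)
    qed simp
    then show ?thesis using False by simp
  qed
qed

text \<open>The ordered product over an arbitrary list of indices: this permits induction on the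
  list and splitting the full product at a given index.\<close>

definition Ql :: "nat list \<Rightarrow> (nat \<Rightarrow> int) \<Rightarrow> fock \<Rightarrow> fock" where
  "Ql xs \<beta> = foldr (\<lambda>a. (\<circ>) (Qp a (\<beta> a))) xs id"

lemma Ql_Nil [simp]: "Ql [] \<beta> v = v" and Ql_Cons [simp]: "Ql (x # xs) \<beta> v = Qp x (\<beta> x) (Ql xs \<beta> v)"
  by (simp_all add: Ql_def)

lemma Ql_append: "Ql (xs @ ys) \<beta> v = Ql xs \<beta> (Ql ys \<beta> v)"
  by (induction xs) auto

lemma Ql_cong: "(\<And>x. x \<in> set xs \<Longrightarrow> \<beta> x = \<gamma> x) \<Longrightarrow> Ql xs \<beta> v = Ql xs \<gamma> v"
  by (induction xs) auto

lemma Ql_Fock: "set xs \<subseteq> {..<n} \<Longrightarrow> v \<in> Fock n \<Longrightarrow> Ql xs \<beta> v \<in> Fock n"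
  by (induction xs) (auto simp: Qp_Fock)

lemma Ql_smul: "set xs \<subseteq> {..<n} \<Longrightarrow> v \<in> Fock n \<Longrightarrow> Ql xs \<beta> (smul c v) = smul c (Ql xs \<beta> v)"
  by (induction xs) (auto simp: Qp_smul Ql_Fock)

lemma pairing_Ql: "set xs \<subseteq> {..<n} \<Longrightarrow> u \<in> Fock n \<Longrightarrow> v \<in> Fock n \<Longrightarrow>
    pairing (Ql xs \<beta> u) (Ql xs \<beta> v) = pairing u v"
  by (induction xs) (auto simp: pairing_Qp Ql_Fock)

lemma intertwiner_Ql:
  assumes f: "intertwiner a f" and a: "a < n" and v: "v \<in> Fock n"
    and "distinct xs" "set xs \<subseteq> {..<n}"
  shows "f k (Ql xs \<beta> v) = smul (sign_pow (\<Sum>x\<in>set xs - {a}. \<beta> x))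
    (Ql xs \<beta> (f (k + (if a \<in> set xs then \<beta> a else 0)) v))"
  using assms(4,5)
proof (induction xs arbitrary: k)
  case (Cons x xs)
  have fF: "f k v \<in> Fock n" for k using f v by (simp add: intertwiner_def)
  have x: "x < n" and xs: "set xs \<subseteq> {..<n}" "distinct xs" "x \<notin> set xs" using Cons by auto
  have "set (x # xs) - {a} = (if x = a then set xs - {a} else insert x (set xs - {a}))"
    by auto
  then have s: "(\<Sum>x\<in>set (x # xs) - {a}. \<beta> x) = (if x = a then 0 else \<beta> x) + (\<Sum>x\<in>set xs - {a}. \<beta> x)"
    using xs by simp
  show ?case
    unfolding s using Cons.IH[OF xs(2,1)] x xs a v
    by (auto simp: intertwiner_Qp[OF f a x] Ql_Fock Ql_smul Qp_smul fF sign_pow_add)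
qed simp

lemma Q_lattice_eq: "Q_lattice n Q \<beta> = Ql [0..<n] \<beta>"
  by (simp add: Q_lattice_def Ql_def)

text \<open>The new factor anticommutes past the powers of all Q_x with x > a, which gives the sign,
  and then merges with the power of Q_a.\<close>

lemma Q_lattice_step:
  assumes a: "a < n" and v: "v \<in> Fock n" and e: "f = Q a \<and> e = 1 \<or> f = Qi a \<and> e = -1"
  shows "Q_lattice n Q \<beta> (f v) = smul (sign_pow (\<Sum>x\<in>{a<..<n}. \<beta> x)) (Q_lattice n Q (\<lambda>x. \<beta> x + e * \<delta> a x) v)"
proof -
  let ?\<beta> = "\<lambda>x. \<beta> x + e * \<delta> a x"
  have i: "intertwiner a (\<lambda>_. f)" using e intertwiner_Q[OF a] intertwiner_Qi[OF a] by auto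
  have f: "f w = Qp a e w" for w using e by (auto simp: Qp_1 Qp_m1)
  have spl: "[0..<n] = [0..<a] @ a # [Suc a..<n]"
    using a by (metis append_Cons append_Nil le_add_same_cancel1 less_imp_le_nat upt_add_eq_append upt_conv_Cons le_iff_add)
  let ?s = "sign_pow (\<Sum>x\<in>{a<..<n}. \<beta> x) :: complex"
  have set: "{Suc a..<n} = {a<..<n}" by auto
  have w: "Ql [Suc a..<n] \<beta> v \<in> Fock n" using v by (intro Ql_Fock) auto
  have "f (Ql [Suc a..<n] \<beta> v) = smul ?s (Ql [Suc a..<n] \<beta> (f v))"
    by (subst intertwiner_Ql[OF i a v]) (auto simp: set)
  then have "Ql [Suc a..<n] \<beta> (f v) = smul ?s (f (Ql [Suc a..<n] \<beta> v))"
    by (simp add: sign_pow_def)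
  then have "Q_lattice n Q \<beta> (f v) = Ql [0..<a] \<beta> (Qp a (\<beta> a) (smul ?s (Qp a e (Ql [Suc a..<n] \<beta> v))))"
    by (simp add: Q_lattice_eq spl Ql_append f)
  also have "\<dots> = smul ?s (Ql [0..<a] \<beta> (Qp a (\<beta> a + e) (Ql [Suc a..<n] \<beta> v)))"
    using a w by (simp add: Qp_smul Qp_Fock Qp_add) (rule Ql_smul; auto simp: Qp_Fock)
  also have "Ql [Suc a..<n] \<beta> v = Ql [Suc a..<n] ?\<beta> v"
    by (intro Ql_cong) (auto simp: \<delta>_def)
  also have "Ql [0..<a] \<beta> (Qp a (\<beta> a + e) (Ql [Suc a..<n] ?\<beta> v)) =
      Ql [0..<a] ?\<beta> (Qp a (\<beta> a + e) (Ql [Suc a..<n] ?\<beta> v))"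
    by (intro Ql_cong) (auto simp: \<delta>_def)
  finally show ?thesis
    by (simp add: Q_lattice_eq spl Ql_append \<delta>_def)
qed

lemma Q_lattice_Fock: "v \<in> Fock n \<Longrightarrow> Q_lattice n Q \<beta> v \<in> Fock n"
  unfolding Q_lattice_eq by (rule Ql_Fock) auto

lemma Q_lattice_smul: "v \<in> Fock n \<Longrightarrow> Q_lattice n Q \<beta> (smul c v) = smul c (Q_lattice n Q \<beta> v)"
  unfolding Q_lattice_eq by (rule Ql_smul) auto

lemma pairing_Q_lattice: "u \<in> Fock n \<Longrightarrow> v \<in> Fock n \<Longrightarrow>
    pairing (Q_lattice n Q \<beta> u) (Q_lattice n Q \<beta> v) = pairing u v"
  unfolding Q_lattice_eq by (rule pairing_Ql) auto

lemma bij_Q_lattice: "bij_betw (Q_lattice n Q \<beta>) (Fock n) (Fock n)"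
proof -
  have 1: "bij_betw (Qp a m) (Fock n) (Fock n)" if "a < n" for a m
    using that by (intro bij_betw_byWitness[where f' = "Qp a (- m)"]) (auto simp: Qp_add Qp_Fock)
  have "bij_betw (Ql xs \<beta>) (Fock n) (Fock n)" if "set xs \<subseteq> {..<n}" for xs
    using that
  proof (induction xs)
    case Nil
    show ?case by (simp add: bij_betw_def inj_on_def)
  next
    case (Cons x xs)
    then have "bij_betw (Qp x (\<beta> x) \<circ> Ql xs \<beta>) (Fock n) (Fock n)"
      by (intro bij_betw_trans[OF Cons.IH] 1) auto
    then show ?case by (simp add: Ql_def o_def)
  qed
  then show ?thesis unfolding Q_lattice_eq by (simp add: subset_eq)
qed

lemma intertwiner_Q_lattice:
  assumes f: "intertwiner a f" and a: "a < n" and v: "v \<in> Fock n"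
  shows "f k (Q_lattice n Q \<beta> v) = smul (sign_pow (\<Sum>x\<in>{..<n} - {a}. \<beta> x))
    (Q_lattice n Q \<beta> (f (k + \<beta> a) v))"
  unfolding Q_lattice_eq using a by (subst intertwiner_Ql[OF f a v]) (auto simp: atLeast0LessThan)

abbreviation Qinv where "Qinv \<beta> \<equiv> inv_into (Fock n) (Q_lattice n Q \<beta>)"

lemma Qinv_Fock: "v \<in> Fock n \<Longrightarrow> Qinv \<beta> v \<in> Fock n"
  using bij_betw_imp_surj_on[OF bij_Q_lattice] by (metis inv_into_into)

lemma Q_lattice_Qinv: "v \<in> Fock n \<Longrightarrow> Q_lattice n Q \<beta> (Qinv \<beta> v) = v"
  by (rule bij_betw_inv_into_right[OF bij_Q_lattice])

lemma Qinv_Q_lattice: "v \<in> Fock n \<Longrightarrow> Qinv \<beta> (Q_lattice n Q \<beta> v) = v"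
  by (rule bij_betw_inv_into_left[OF bij_Q_lattice])

lemma Qinv_smul:
  assumes v: "v \<in> Fock n" shows "Qinv \<beta> (smul c v) = smul c (Qinv \<beta> v)"
  using Q_lattice_smul[OF Qinv_Fock[OF v], of \<beta> c \<beta>] Qinv_Q_lattice[OF Fock_smul[OF Qinv_Fock[OF v]], of \<beta> c \<beta>]
    Q_lattice_Qinv[OF v] by simp

lemma pairing_Q_lattice_right:
  "u \<in> Fock n \<Longrightarrow> v \<in> Fock n \<Longrightarrow> pairing u (Q_lattice n Q \<beta> v) = pairing (Qinv \<beta> u) v"
  by (metis Qinv_Fock Q_lattice_Qinv pairing_Q_lattice)

lemma intertwiner_Qinv:
  assumes f: "intertwiner a f" and a: "a < n" and v: "v \<in> Fock n"
  shows "f k (Qinv \<beta> v) = smul (sign_pow (\<Sum>x\<in>{..<n} - {a}. \<beta> x)) (Qinv \<beta> (f (k - \<beta> a) v))"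
proof -
  let ?s = "sign_pow (\<Sum>x\<in>{..<n} - {a}. \<beta> x) :: complex"
  have fF: "f k v \<in> Fock n" if "v \<in> Fock n" for k v using f that by (simp add: intertwiner_def)
  have "f (k - \<beta> a) v = smul ?s (Q_lattice n Q \<beta> (f k (Qinv \<beta> v)))"
    using intertwiner_Q_lattice[OF f a Qinv_Fock[OF v], of "k - \<beta> a" \<beta> \<beta>] v by (simp add: Q_lattice_Qinv)
  then have "Qinv \<beta> (f (k - \<beta> a) v) = smul ?s (f k (Qinv \<beta> v))"
    using v by (simp add: Qinv_smul Q_lattice_Fock fF Qinv_Fock Qinv_Q_lattice)
  then show ?thesis by (simp add: sign_pow_def)
qed

section \<open>Fermions acting on Q^gamma v_0\<close>

lemma wedge_v0: "0 \<le> k \<Longrightarrow> a < n \<Longrightarrow> wedge (k, a) (v0 n) = 0"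
  by (simp add: v0_def wedge_single vac_def)

lemma contract_v0: "k < 0 \<Longrightarrow> contract (k, a) (v0 n) = 0"
  by (simp add: v0_def contract_single vac_def)

lemma wedge_Q_lattice_v0: "a < n \<Longrightarrow> - \<gamma> a \<le> k \<Longrightarrow> wedge (k, a) (Q_lattice n Q \<gamma> (v0 n)) = 0"
  using intertwiner_Q_lattice[OF intertwiner_wedge _ v0_Fock] wedge_v0[of "k + \<gamma> a" a]
    Q_lattice_smul[OF Fock_zero, of \<gamma> 0] by simp

lemma contract_Q_lattice_v0: "a < n \<Longrightarrow> k < - \<gamma> a \<Longrightarrow> contract (k, a) (Q_lattice n Q \<gamma> (v0 n)) = 0"
  using intertwiner_Q_lattice[OF intertwiner_contract _ v0_Fock] contract_v0[of "k + \<gamma> a" a]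
    Q_lattice_smul[OF Fock_zero, of \<gamma> 0] by simp

text \<open>The first sign comes from moving a fermion of component \<open>a\<close> past all other
  factors, the second from bringing the resulting Q_a back to its place. What remains is the sum
  over smaller indices, as in the cocycle.\<close>

lemma sign_split:
  assumes "a < n"
  shows "sign_pow (\<Sum>x\<in>{..<n} - {a}. \<gamma> x) * sign_pow (\<Sum>x\<in>{a<..<n}. \<gamma> x) = (sign_pow (\<Sum>x<a. \<gamma> x) :: complex)"
proof -
  have "{..<n} - {a} = {..<a} \<union> {a<..<n}" using assms by auto
  moreover have "sum \<gamma> ({..<a} \<union> {a<..<n}) = (\<Sum>x<a. \<gamma> x) + (\<Sum>x\<in>{a<..<n}. \<gamma> x)"
    by (rule sum.union_disjoint) auto
  ultimately have "(\<Sum>x\<in>{..<n} - {a}. \<gamma> x) = (\<Sum>x<a. \<gamma> x) + (\<Sum>x\<in>{a<..<n}. \<gamma> x)"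
    by (rule ssubst)
  then show ?thesis unfolding sign_pow_add[symmetric] by (intro sign_pow_cong) simp
qed

text \<open>Pulled through Q^gamma, the empty level next to the filled ones becomes level -1, and
  wedging v_0 there gives Q_a v_0.\<close>

lemma wedge_Q_lattice_v0_top:
  assumes a: "a < n"
  shows "wedge (- \<gamma> a - 1, a) (Q_lattice n Q \<gamma> (v0 n)) = smul (sign_pow (\<Sum>x<a. \<gamma> x)) (Q_lattice n Q (\<gamma> + \<delta> a) (v0 n))"
proof -
  have *: "(\<lambda>x. \<gamma> x + \<delta> a x) = \<gamma> + \<delta> a" by (simp add: fun_eq_iff)
  have "wedge (- \<gamma> a - 1, a) (Q_lattice n Q \<gamma> (v0 n)) =
      smul (sign_pow (\<Sum>x\<in>{..<n} - {a}. \<gamma> x)) (Q_lattice n Q \<gamma> (Q a (v0 n)))"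
    using intertwiner_Q_lattice[OF intertwiner_wedge[OF a] a v0_Fock, of "- \<gamma> a - 1" \<gamma>] a by (simp add: Q_v0)
  also have "Q_lattice n Q \<gamma> (Q a (v0 n)) = smul (sign_pow (\<Sum>x\<in>{a<..<n}. \<gamma> x)) (Q_lattice n Q (\<gamma> + \<delta> a) (v0 n))"
    using Q_lattice_step[OF a v0_Fock, of "Q a" 1 \<gamma>] by (simp add: *)
  finally show ?thesis using sign_split[OF a] by simp
qed

text \<open>Likewise the lowest filled level becomes level 0, and contracting v_0 there gives the
  inverse of Q_a on v_0.\<close>

lemma contract_Q_lattice_v0_top:
  assumes a: "a < n"
  shows "contract (- \<gamma> a, a) (Q_lattice n Q \<gamma> (v0 n)) = smul (sign_pow (\<Sum>x<a. \<gamma> x)) (Q_lattice n Q (\<gamma> - \<delta> a) (v0 n))"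
proof -
  have *: "(\<lambda>x. \<gamma> x - \<delta> a x) = \<gamma> - \<delta> a" by (simp add: fun_eq_iff)
  have "contract (- \<gamma> a, a) (Q_lattice n Q \<gamma> (v0 n)) =
      smul (sign_pow (\<Sum>x\<in>{..<n} - {a}. \<gamma> x)) (Q_lattice n Q \<gamma> (Qi a (v0 n)))"
    using intertwiner_Q_lattice[OF intertwiner_contract[OF a] a v0_Fock, of "- \<gamma> a" \<gamma>] a by (simp add: inv_Q_v0)
  also have "Q_lattice n Q \<gamma> (Qi a (v0 n)) = smul (sign_pow (\<Sum>x\<in>{a<..<n}. \<gamma> x)) (Q_lattice n Q (\<gamma> - \<delta> a) (v0 n))"
    using Q_lattice_step[OF a v0_Fock, of "Qi a" "-1" \<gamma>] by (simp add: *)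
  finally show ?thesis using sign_split[OF a] by simp
qed

end


section \<open>Bilinear identities\<close>

definition pair_series :: "fock \<Rightarrow> fock_series \<Rightarrow> cvar mseries" where
  "pair_series u V = Mseries (\<lambda>m. pairing u (V m))"

definition sites :: "fock \<Rightarrow> fock \<Rightarrow> site set" where
  "sites u w = {s. contract s u \<noteq> 0 \<and> wedge s w \<noteq> 0}"

text \<open>The pairing of $u \otimes w$ with $\Omega(V \otimes W)$, with the operators $s \wedge$ and $i(s)$
  moved to \<open>u\<close> and \<open>w\<close>, where only finitely many \<open>s\<close> contribute.\<close>

definition Omega :: "fock \<Rightarrow> fock \<Rightarrow> fock_series \<Rightarrow> fock_series \<Rightarrow> cvar mseries" where
  "Omega u w V W = (\<Sum>s\<in>sites u w. pair_series (contract s u) V * pair_series (wedge s w) W)"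

lemma pair_series_zero [simp]: "pair_series 0 V = 0"
  by (simp add: pair_series_def zero_mseries_def)

lemma pair_series_add: "pair_series (u + u') V = pair_series u V + pair_series u' V"
  by (simp add: pair_series_def plus_mseries_def pairing_add_left)

lemma pair_series_uminus: "pair_series (- u) V = - pair_series u V"
  by (simp add: pair_series_def uminus_mseries_def pairing_uminus_left)

lemma pair_series_diff: "pair_series (u - u') V = pair_series u V - pair_series u' V"
  using pair_series_add[of u "- u'" V] by (simp add: pair_series_uminus)

lemma sites_snd: "u \<in> Fock n \<Longrightarrow> s \<in> sites u w \<Longrightarrow> snd s < n"
proof (rule ccontr)
  assume u: "u \<in> Fock n" and s: "s \<in> sites u w" and n: "\<not> snd s < n"
  have "contract s u = 0"
  proof (rule linear_eqI[OF u, where B = "\<lambda>_. 0"])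
    fix S c assume "S \<in> states n"
    with n have "s \<notin> S" using states_snd by blast
    then show "contract s (Poly_Mapping.single S c) = 0" by (simp add: contract_single)
  qed (simp_all add: contract_add)
  with s show False by (simp add: sites_def)
qed

text \<open>A contributing site lies in some monomial S of \<open>u\<close> and outside some
  monomial T of \<open>w\<close>. The set S - T is finite because both differ from the vacuum in
  finitely many places.\<close>

lemma finite_sites:
  assumes u: "u \<in> Fock n" and w: "w \<in> Fock n"
  shows "finite (sites u w)"
proof (rule finite_subset)
  let ?X = "\<lambda>S T. (S - vac n) \<union> (vac n - T)"
  show "sites u w \<subseteq> (\<Union>S\<in>Poly_Mapping.keys u. \<Union>T\<in>Poly_Mapping.keys w. ?X S T)"
  proof
    fix s assume "s \<in> sites u w"
    then have "contract s u \<noteq> 0" "wedge s w \<noteq> 0" by (auto simp: sites_def)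
    then obtain S T where "S \<in> Poly_Mapping.keys u" "s \<in> S" "T \<in> Poly_Mapping.keys w" "s \<notin> T"
      unfolding contract_def wedge_def lin_ext_def
      by (smt (verit, best) sum.neutral smul_simps(5))
    then show "s \<in> (\<Union>S\<in>Poly_Mapping.keys u. \<Union>T\<in>Poly_Mapping.keys w. ?X S T)" by blast
  qed
  show "finite (\<Union>S\<in>Poly_Mapping.keys u. \<Union>T\<in>Poly_Mapping.keys w. ?X S T)"
  proof (intro finite_UN_I finite_keys)
    fix S T assume "S \<in> Poly_Mapping.keys u" "T \<in> Poly_Mapping.keys w"
    then have "S \<in> states n" "T \<in> states n" using u w by (auto simp: Fock_def)
    then show "finite (?X S T)" by (simp add: states_def)
  qed
qed

text \<open>Pairings with different test vectors have different index sets; this brings them to a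
  common one before they are compared.\<close>

lemma Omega_superset:
  assumes "finite A" "sites u w \<subseteq> A"
  shows "Omega u w V W = (\<Sum>s\<in>A. pair_series (contract s u) V * pair_series (wedge s w) W)"
  unfolding Omega_def using assms by (intro sum.mono_neutral_left) (auto simp: sites_def)

text \<open>The matrix unit with row \<open>s\<close> and column \<open>t\<close>, acting on the
  Fock space. Its adjoint is \<open>hop t s\<close>.\<close>

definition hop :: "site \<Rightarrow> site \<Rightarrow> fock \<Rightarrow> fock" where
  "hop s t v = wedge s (contract t v)"

lemma hop_Fock: "v \<in> Fock n \<Longrightarrow> snd s < n \<Longrightarrow> hop s t v \<in> Fock n"
  by (simp add: hop_def Fock_wedge Fock_contract)

lemma hop_sum: "hop s t (\<Sum>i\<in>A. f i) = (\<Sum>i\<in>A. hop s t (f i))"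
  by (simp add: hop_def wedge_def contract_def lin_ext_sum)

lemma wedge_diff: "wedge s (u - v) = wedge s u - wedge s v"
  using wedge_add[of s u "- v"] by (simp add: wedge_uminus)

lemma hop_smul: "hop s t (smul c v) = smul c (hop s t v)"
  by (simp add: hop_def wedge_smul contract_smul)

lemma hop_zero [simp]: "hop s t 0 = 0"
  by (simp add: hop_def)

lemma pairing_hop: "pairing u (hop s t v) = pairing (hop t s u) v"
  by (simp add: hop_def pairing_wedge pairing_contract)

lemma contract_hop:
  assumes u: "u \<in> Fock n" and q: "snd q < n"
  shows "hop q p (contract s u) = contract s (hop q p u) - (if s = q then contract p u else 0)"
  using u by (simp add: hop_def contract_wedge[OF Fock_contract] contract_contract[OF u, of s p] wedge_uminus)

lemma wedge_hop:
  assumes w: "w \<in> Fock n" and s: "snd s < n"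
  shows "hop q p (wedge s w) = wedge s (hop q p w) + (if s = p then wedge q w else 0)"
  using w wedge_wedge[OF Fock_contract[OF w], of s q p] by (simp add: hop_def contract_wedge wedge_diff)

lemma hop_hop:
  assumes "v \<in> Fock n" "snd s < n" "snd s' < n" "s \<noteq> t'" "s' \<noteq> t"
  shows "hop s t (hop s' t' v) = hop s' t' (hop s t v)"
proof -
  have "hop s t (hop s' t' v) = wedge s (- wedge s' (contract t (contract t' v)))"
    using assms by (simp add: hop_def contract_wedge[OF Fock_contract])
  also have "\<dots> = wedge s' (wedge s (contract t (contract t' v)))"
    using assms wedge_wedge[of "contract t (contract t' v)" n s s'] by (simp add: wedge_uminus Fock_contract)
  also have "\<dots> = wedge s' (- wedge s (contract t' (contract t v)))"
    using contract_contract[OF assms(1), of t t'] by (simp add: wedge_uminus)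
  also have "\<dots> = hop s' t' (hop s t v)"
    using assms by (simp add: hop_def contract_wedge[OF Fock_contract])
  finally show ?thesis .
qed

text \<open>For s different from t the wedging and contraction factors anticommute, which brings the
  two contractions together; \<open>contract t\<close> squares to zero since it anticommutes with
  itself.\<close>

lemma hop_hop_same:
  assumes "v \<in> Fock n" "snd s < n" "s \<noteq> t"
  shows "hop s t (hop s t v) = 0"
proof -
  have "contract t (contract t v) = 0"
  proof (rule poly_mapping_eqI)
    fix S
    from contract_contract[OF assms(1), of t t]
    have "Poly_Mapping.lookup (contract t (contract t v)) S = Poly_Mapping.lookup (- contract t (contract t v)) S"
      by simp
    then show "Poly_Mapping.lookup (contract t (contract t v)) S = Poly_Mapping.lookup 0 S" by simp
  qed
  then show ?thesis using assms by (simp add: hop_def contract_wedge[OF Fock_contract] wedge_uminus)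
qed

text \<open>The commutation of \<open>hop p q\<close> with $\Omega$, in terms of adjoints: the two commutators of
  \<open>hop q p\<close>, with \<open>contract s\<close> and with \<open>wedge s\<close>, cancel in the sum over \<open>s\<close>.\<close>

lemma hop_Omega:
  assumes u: "u \<in> Fock n" and w: "w \<in> Fock n" and p: "snd p < n" and q: "snd q < n"
    and A: "finite A" "sites u w \<subseteq> A" "sites (hop q p u) w \<subseteq> A" "sites u (hop q p w) \<subseteq> A"
      "p \<in> A" "q \<in> A" "\<And>s. s \<in> A \<Longrightarrow> snd s < n"
  shows "(\<Sum>s\<in>A. pair_series (hop q p (contract s u)) V * pair_series (wedge s w) W +
       pair_series (contract s u) V * pair_series (hop q p (wedge s w)) W) =
     Omega (hop q p u) w V W + Omega u (hop q p w) V W"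
proof -
  have "pair_series (hop q p (contract s u)) V * pair_series (wedge s w) W +
       pair_series (contract s u) V * pair_series (hop q p (wedge s w)) W =
     pair_series (contract s (hop q p u)) V * pair_series (wedge s w) W +
     pair_series (contract s u) V * pair_series (wedge s (hop q p w)) W
     + ((if s = p then pair_series (contract p u) V * pair_series (wedge q w) W else 0)
      - (if s = q then pair_series (contract p u) V * pair_series (wedge q w) W else 0))" if "s \<in> A" for s
  proof -
    have "pair_series (hop q p (contract s u)) V = pair_series (contract s (hop q p u)) V -
        (if s = q then pair_series (contract p u) V else 0)"
      by (simp add: contract_hop[OF u q] pair_series_diff)
    moreover have "pair_series (hop q p (wedge s w)) W = pair_series (wedge s (hop q p w)) W +
        (if s = p then pair_series (wedge q w) W else 0)"
      by (simp add: wedge_hop[OF w A(7)[OF that]] pair_series_add)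
    ultimately show ?thesis by (simp only:) (simp add: algebra_simps)
  qed
  then show ?thesis
    using A by (simp add: Omega_superset[of A] sum.distrib sum_subtractf)
qed

section \<open>The exponentials of \<open>Gamma\<close>, coefficient by coefficient\<close>

definition pair_of :: "cvar \<Rightarrow> nat \<times> nat" where
  "pair_of v = (case v of (a, b, k, l) \<Rightarrow> (a, b))"

definition pair_degree :: "nat \<Rightarrow> nat \<Rightarrow> cvar multiset \<Rightarrow> nat" where
  "pair_degree a b m = size (filter_mset (\<lambda>v. pair_of v = (a, b)) m)"

text \<open>A set and not a multiset: a variable dividing \<open>m\<close> gives one term in the
  coefficient of \<open>Gamma\<close> at \<open>m\<close>, whatever its multiplicity.\<close>

definition pair_vars :: "nat \<Rightarrow> nat \<Rightarrow> cvar multiset \<Rightarrow> cvar set" where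
  "pair_vars a b m = {v \<in> set_mset m. pair_of v = (a, b)}"

text \<open>The variable c^{a,b}_{k,l} multiplies the matrix unit from level l of component b to
  level -k - 1 of component a; the level l arises as -(-l - 1) - 1 from the mode of
  \<open>psi_minus\<close>.\<close>

definition created :: "cvar \<Rightarrow> site" where
  "created v = (case v of (a, b, k, l) \<Rightarrow> (- k - 1, a))"

definition destroyed :: "cvar \<Rightarrow> site" where
  "destroyed v = (case v of (a, b, k, l) \<Rightarrow> (l, b))"

lemma snd_created: "pair_of v = (a, b) \<Longrightarrow> snd (created v) = a"
  and snd_destroyed: "pair_of v = (a, b) \<Longrightarrow> snd (destroyed v) = b"
  by (auto simp: pair_of_def created_def destroyed_def split: prod.splits)

lemma finite_pair_vars [simp]: "finite (pair_vars a b m)"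
  by (simp add: pair_vars_def)

lemma Gamma_eq: "Gamma a b V m = (\<Sum>v\<in>pair_vars a b m. hop (created v) (destroyed v) (V (m - {#v#})))"
  unfolding Gamma_def
  by (rule sum.reindex_bij_witness[where i = "\<lambda>(a, b, k, l). (k, l)" and j = "\<lambda>(k, l). (a, b, k, l)"])
     (auto simp: pair_vars_def pair_of_def hop_def created_def destroyed_def psi_plus_def psi_minus_def)

lemma pair_degree_remove: "v \<in> pair_vars a b m \<Longrightarrow> pair_degree a b m = Suc (pair_degree a b (m - {#v#}))"
  by (auto simp: pair_degree_def pair_vars_def dest!: multi_member_split)

lemma pair_degree_0: "pair_degree a b m = 0 \<longleftrightarrow> pair_vars a b m = {}"
  by (auto simp: pair_degree_def pair_vars_def filter_mset_eq_conv)

lemma pair_degree_add: "pair_degree a b (p + q) = pair_degree a b p + pair_degree a b q"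
  by (simp add: pair_degree_def)

lemma pair_degree_le: "pair_degree a b m \<le> size m"
  by (simp add: pair_degree_def size_filter_mset_lesseq)

lemma exp_Gamma_deg_0:
  assumes "pair_degree a b m = 0" shows "exp_Gamma a b V m = V m"
proof -
  have "(Gamma a b ^^ s) V m = (if s = 0 then V m else 0)" for s
    using assms by (cases s) (simp_all add: Gamma_eq pair_degree_0)
  then have "exp_Gamma a b V m = (\<Sum>s\<le>size m. if s = 0 then V m else 0)"
    unfolding exp_Gamma_def by (intro sum.cong) auto
  then show ?thesis by simp
qed

text \<open>Euler's equation, which replaces the exponential series in all that follows: only one power
  of \<open>Gamma a b\<close> contributes to each coefficient.\<close>

lemma Gamma_Euler:
  assumes V: "\<And>m. pair_degree a b m \<noteq> 0 \<Longrightarrow> V m = 0"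
  shows "Gamma a b (exp_Gamma a b V) m = smul (of_nat (pair_degree a b m)) (exp_Gamma a b V m)"
proof -
  have pow: "(Gamma a b ^^ s) V m = 0" if "pair_degree a b m \<noteq> s" for s m
    using that
  proof (induction s arbitrary: m)
    case (Suc s)
    have "(Gamma a b ^^ s) V (m - {#v#}) = 0" if "v \<in> pair_vars a b m" for v
      using Suc pair_degree_remove[OF that] by auto
    then show ?case by (simp add: Gamma_eq[of a b "(Gamma a b ^^ s) V"])
  qed (simp add: V)
  have E: "exp_Gamma a b V m = smul (1 / fact (pair_degree a b m)) ((Gamma a b ^^ pair_degree a b m) V m)" for m
  proof -
    have "exp_Gamma a b V m = (\<Sum>s\<le>size m. if s = pair_degree a b m
        then smul (1 / fact (pair_degree a b m)) ((Gamma a b ^^ pair_degree a b m) V m) else 0)"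
      unfolding exp_Gamma_def by (intro sum.cong) (auto simp: pow)
    then show ?thesis using pair_degree_le[of a b m] by simp
  qed
  show ?thesis
  proof (cases "pair_degree a b m")
    case 0
    then have "pair_vars a b m = {}" by (simp add: pair_degree_0)
    with 0 show ?thesis by (simp add: Gamma_eq)
  next
    case (Suc d)
    have "Gamma a b (exp_Gamma a b V) m = (\<Sum>v\<in>pair_vars a b m.
        smul (1 / fact d) (hop (created v) (destroyed v) ((Gamma a b ^^ d) V (m - {#v#}))))"
      unfolding Gamma_eq[of a b "exp_Gamma a b V"] using Suc
      by (intro sum.cong refl) (use pair_degree_remove in \<open>fastforce simp: E hop_smul\<close>)
    also have "\<dots> = smul (1 / fact d) (Gamma a b ((Gamma a b ^^ d) V) m)"
      by (simp add: Gamma_eq[of a b "(Gamma a b ^^ d) V"] smul_sum)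
    also have "(1 :: complex) / fact d = of_nat (Suc d) * (1 / fact (Suc d))"
      by (simp add: field_simps del: of_nat_Suc)
    finally show ?thesis unfolding E Suc by (simp only: smul_simps funpow.simps o_apply)
  qed
qed

text \<open>Choosing a splitting m = p + q and then a variable of p amounts to choosing the variable
  first and then splitting the rest. The matrix unit passes to \<open>u\<close> as its adjoint, with
  the roles of created and destroyed site exchanged.\<close>

lemma mcoeff_times_pair_series_Gamma:
  "mcoeff (pair_series u (Gamma a b V) * f) m =
    (\<Sum>v\<in>pair_vars a b m. mcoeff (pair_series (hop (destroyed v) (created v) u) V * f) (m - {#v#}))"
proof -
  let ?h = "\<lambda>v p q. pairing (hop (destroyed v) (created v) u) (V p) * mcoeff f q"
  let ?A = "SIGMA x:{(p, q). p + q = m}. pair_vars a b (fst x)"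
  let ?B = "SIGMA v:pair_vars a b m. {(p, q). p + q = m - {#v#}}"
  have "mcoeff (pair_series u (Gamma a b V) * f) m =
      (\<Sum>x\<in>{(p, q). p + q = m}. \<Sum>v\<in>pair_vars a b (fst x). ?h v (fst x - {#v#}) (snd x))"
    by (auto simp: times_mseries_def pair_series_def Gamma_eq pairing_sum_right pairing_hop
        sum_distrib_right case_prod_beta intro!: sum.cong)
  also have "\<dots> = (\<Sum>(x, v)\<in>?A. ?h v (fst x - {#v#}) (snd x))"
    by (rule sum.Sigma) (use finite_splittings in auto)
  also have "\<dots> = (\<Sum>(v, x)\<in>?B. ?h v (fst x) (snd x))"
    by (rule sum.reindex_bij_witness[where i = "\<lambda>(v, (p, q)). ((add_mset v p, q), v)"
          and j = "\<lambda>((p, q), v). (v, (p - {#v#}, q))"])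
       (auto simp: pair_vars_def)
  also have "\<dots> = (\<Sum>v\<in>pair_vars a b m. \<Sum>x\<in>{(p, q). p + q = m - {#v#}}. ?h v (fst x) (snd x))"
    by (rule sum.Sigma[symmetric]) (use finite_splittings in auto)
  finally show ?thesis
    by (simp add: times_mseries_def pair_series_def case_prod_beta)
qed

section \<open>Invariance of the Casimir pairing under one exponential\<close>

lemma mcoeff_sum: "mcoeff (\<Sum>i\<in>A. f i) m = (\<Sum>i\<in>A. mcoeff (f i) m)"
  by (induction A rule: infinite_finite_induct) (auto simp: zero_mseries_def plus_mseries_def)

lemma mcoeff_add: "mcoeff (f + g) m = mcoeff f m + mcoeff g m"
  by (simp add: plus_mseries_def)

text \<open>The Leibniz rule for the Euler derivation, which multiplies each monomial by its degree
  in the variables of the pair.\<close>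

lemma pair_degree_mcoeff_times:
  "of_nat (pair_degree a b m) * mcoeff (f * g) m =
    mcoeff (Mseries (\<lambda>p. of_nat (pair_degree a b p) * mcoeff f p) * g) m +
    mcoeff (f * Mseries (\<lambda>p. of_nat (pair_degree a b p) * mcoeff g p)) m"
proof -
  have "of_nat (pair_degree a b m) * mcoeff (f * g) m =
     (\<Sum>(p, q)\<in>{(p, q). p + q = m}. of_nat (pair_degree a b p) * mcoeff f p * mcoeff g q +
       mcoeff f p * (of_nat (pair_degree a b q) * mcoeff g q))"
    unfolding times_mseries_def mcoeff_Mseries sum_distrib_left
    by (intro sum.cong) (auto simp: pair_degree_add algebra_simps)
  then show ?thesis
    by (simp add: times_mseries_def sum.distrib case_prod_beta)
qed

lemma pair_series_Gamma_Euler: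
  assumes "\<And>m. pair_degree a b m \<noteq> 0 \<Longrightarrow> V m = 0"
  shows "Mseries (\<lambda>p. of_nat (pair_degree a b p) * mcoeff (pair_series u (exp_Gamma a b V)) p) =
    pair_series u (Gamma a b (exp_Gamma a b V))"
  by (simp add: Gamma_Euler[of a b V, OF assms] pair_series_def pairing_smul_right)

text \<open>In degree zero the exponentials coincide with \<open>V\<close> and \<open>W\<close>.
  Otherwise the coefficient times its degree is rewritten by the Leibniz rule and Euler's equation,
  and \<open>hop_Omega\<close> turns it into coefficients of \<open>Omega\<close> at smaller
  monomials for modified test vectors. The assumptions on \<open>V\<close> and \<open>W\<close> say
  that the variables of this pair are still fresh.\<close>

lemma Omega_exp_Gamma:
  assumes ab: "a < n" "b < n"
    and V: "\<And>m. pair_degree a b m \<noteq> 0 \<Longrightarrow> V m = 0" and W: "\<And>m. pair_degree a b m \<noteq> 0 \<Longrightarrow> W m = 0"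
    and Z: "\<And>u w. u \<in> Fock n \<Longrightarrow> w \<in> Fock n \<Longrightarrow> Omega u w V W = 0"
    and u: "u \<in> Fock n" and w: "w \<in> Fock n"
  shows "Omega u w (exp_Gamma a b V) (exp_Gamma a b W) = 0"
proof -
  define EV EW where "EV = exp_Gamma a b V" and "EW = exp_Gamma a b W"
  have "mcoeff (Omega u w EV EW) m = 0" if "u \<in> Fock n" "w \<in> Fock n" for u w m
    using that
  proof (induction m arbitrary: u w rule: measure_induct_rule[where f = size])
    case (less m)
    note u = less.prems(1) and w = less.prems(2)
    show ?case
    proof (cases "pair_degree a b m = 0")
      case True
      have "mcoeff (pair_series x EV * pair_series y EW) m = mcoeff (pair_series x V * pair_series y W) m" for x y
        unfolding times_mseries_def mcoeff_Mseries
      proof (intro sum.cong refl, clarify)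
        fix p q assume "m = p + q"
        with True have "pair_degree a b p = 0" "pair_degree a b q = 0" by (simp_all add: pair_degree_add)
        then show "mcoeff (pair_series x EV) p * mcoeff (pair_series y EW) q =
            mcoeff (pair_series x V) p * mcoeff (pair_series y W) q"
          by (simp add: pair_series_def EV_def EW_def exp_Gamma_deg_0)
      qed
      then have "mcoeff (Omega u w EV EW) m = mcoeff (Omega u w V W) m"
        by (simp add: Omega_def mcoeff_sum)
      then show ?thesis using Z[OF u w] by (simp add: zero_mseries_def)
    next
      case False
      let ?c = created and ?d = destroyed
      have snd: "snd (?c v) < n" "snd (?d v) < n" if "v \<in> pair_vars a b m" for v
        using that ab snd_created snd_destroyed by (auto simp: pair_vars_def)
      \<comment> \<open>One index set for all pairings that will occur, together with the sites
        where the commutators of the matrix units are non-zero.\<close>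
      define A where "A = sites u w \<union> (\<Union>v\<in>pair_vars a b m.
          sites (hop (?d v) (?c v) u) w \<union> sites u (hop (?d v) (?c v) w) \<union> {?c v, ?d v})"
      have hopF: "hop (?d v) (?c v) x \<in> Fock n" if "x \<in> Fock n" "v \<in> pair_vars a b m" for x v
        using that snd by (simp add: hop_Fock)
      have A: "finite A" using u w by (auto simp: A_def intro!: finite_sites hopF)
      have An: "snd s < n" if "s \<in> A" for s
        using that u snd unfolding A_def by (auto dest: sites_snd[rotated] intro: hopF)
      have "of_nat (pair_degree a b m) * mcoeff (Omega u w EV EW) m =
        (\<Sum>s\<in>A. of_nat (pair_degree a b m) * mcoeff (pair_series (contract s u) EV * pair_series (wedge s w) EW) m)"
        by (simp add: Omega_superset[OF A] A_def mcoeff_sum sum_distrib_left)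
      also have "\<dots> = (\<Sum>s\<in>A. mcoeff (pair_series (contract s u) (Gamma a b EV) * pair_series (wedge s w) EW) m +
          mcoeff (pair_series (wedge s w) (Gamma a b EW) * pair_series (contract s u) EV) m)"
        unfolding pair_degree_mcoeff_times EV_def EW_def
        by (simp add: pair_series_Gamma_Euler V W mult.commute)
      also have "\<dots> = (\<Sum>s\<in>A. \<Sum>v\<in>pair_vars a b m.
          mcoeff (pair_series (hop (?d v) (?c v) (contract s u)) EV * pair_series (wedge s w) EW +
            pair_series (contract s u) EV * pair_series (hop (?d v) (?c v) (wedge s w)) EW) (m - {#v#}))"
        by (simp add: mcoeff_times_pair_series_Gamma mcoeff_add sum.distrib
            mult.commute[of "pair_series (contract s u) EV" "pair_series (hop p q (wedge s w)) EW" for s p q])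
      also have "\<dots> = (\<Sum>v\<in>pair_vars a b m. mcoeff (\<Sum>s\<in>A.
          pair_series (hop (?d v) (?c v) (contract s u)) EV * pair_series (wedge s w) EW +
            pair_series (contract s u) EV * pair_series (hop (?d v) (?c v) (wedge s w)) EW) (m - {#v#}))"
        unfolding mcoeff_sum by (rule sum.swap)
      also have "\<dots> = (\<Sum>v\<in>pair_vars a b m. mcoeff (Omega (hop (?d v) (?c v) u) w EV EW +
          Omega u (hop (?d v) (?c v) w) EV EW) (m - {#v#}))"
      proof (intro sum.cong refl)
        fix v assume v: "v \<in> pair_vars a b m"
        show "mcoeff (\<Sum>s\<in>A.
          pair_series (hop (?d v) (?c v) (contract s u)) EV * pair_series (wedge s w) EW +
            pair_series (contract s u) EV * pair_series (hop (?d v) (?c v) (wedge s w)) EW) (m - {#v#}) =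
          mcoeff (Omega (hop (?d v) (?c v) u) w EV EW + Omega u (hop (?d v) (?c v) w) EV EW) (m - {#v#})"
          by (subst hop_Omega[OF u w snd[OF v] A]) (use v An in \<open>auto simp: A_def\<close>)
      qed
      also have "\<dots> = 0"
      proof (intro sum.neutral ballI)
        fix v assume v: "v \<in> pair_vars a b m"
        then have "size (m - {#v#}) < size m" by (auto simp: pair_vars_def size_Diff1_less)
        then show "mcoeff (Omega (hop (?d v) (?c v) u) w EV EW + Omega u (hop (?d v) (?c v) w) EV EW) (m - {#v#}) = 0"
          using v u w by (simp add: mcoeff_add less.IH hopF)
      qed
      finally show ?thesis using False by simp
    qed
  qed
  from this[OF u w] show ?thesis
    by (intro mseries_eqI) (simp add: EV_def EW_def zero_mseries_def)
qed

section \<open>Which variables occur in an exponential, and how often\<close>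

lemma Fock_Gamma:
  assumes "a < n" "\<And>m. V m \<in> Fock n" shows "Gamma a b V m \<in> Fock n"
  unfolding Gamma_eq using assms snd_created
  by (intro Fock_sum hop_Fock) (auto simp: pair_vars_def)

lemma Fock_exp_Gamma:
  assumes "a < n" "\<And>m. V m \<in> Fock n" shows "exp_Gamma a b V m \<in> Fock n"
proof -
  have "(Gamma a b ^^ s) V m \<in> Fock n" for s m
    by (induction s arbitrary: m) (auto simp: assms intro!: Fock_Gamma)
  then show ?thesis unfolding exp_Gamma_def by (intro Fock_sum Fock_smul)
qed

lemma smul_eq_0: "smul c v = 0 \<Longrightarrow> c \<noteq> 0 \<Longrightarrow> v = 0"
  by (metis left_inverse smul_simps(3,5,6))

text \<open>An exponential introduces variables of its own pair only: Euler's equation leads to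
  smaller monomials that still contain \<open>v\<close>, down to degree zero, where \<open>V\<close>
  vanishes. This keeps the variables of later pairs fresh.\<close>

lemma exp_Gamma_new_vars:
  assumes V: "\<And>m. pair_degree a b m \<noteq> 0 \<Longrightarrow> V m = 0"
    and v: "v \<in># m" "pair_of v \<noteq> (a, b)" "\<And>m. v \<in># m \<Longrightarrow> V m = 0"
  shows "exp_Gamma a b V m = 0"
  using v(1)
proof (induction m rule: measure_induct_rule[where f = size])
  case (less m)
  show ?case
  proof (cases "pair_degree a b m = 0")
    case True
    then show ?thesis using v less.prems by (simp add: exp_Gamma_deg_0)
  next
    case False
    have "exp_Gamma a b V (m - {#x#}) = 0" if "x \<in> pair_vars a b m" for x
    proof (rule less.IH)
      show "size (m - {#x#}) < size m" using that by (auto simp: pair_vars_def size_Diff1_less)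
      have "x \<noteq> v" using that v by (auto simp: pair_vars_def)
      then show "v \<in># m - {#x#}" using less.prems by (simp add: in_diff_count)
    qed
    then have "Gamma a b (exp_Gamma a b V) m = 0" by (simp add: Gamma_eq)
    then show ?thesis using Gamma_Euler[of a b V, OF V] False smul_eq_0 by force
  qed
qed

text \<open>The reason is that \<open>hop s t\<close> squares to zero for $s \neq t$.\<close>

lemma exp_Gamma_multiplicity:
  assumes ab: "a < n" "b < n" "a \<noteq> b"
    and VF: "\<And>m. V m \<in> Fock n"
    and V: "\<And>m. pair_degree a b m \<noteq> 0 \<Longrightarrow> V m = 0"
    and V2: "\<And>m v. 2 \<le> count m v \<Longrightarrow> V m = 0"
    and v: "2 \<le> count m v"
  shows "exp_Gamma a b V m = 0"
proof -
  let ?E = "exp_Gamma a b V"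
  have E: "?E m \<in> Fock n" for m by (rule Fock_exp_Gamma[OF ab(1) VF])
  \<comment> \<open>The second conjunct carries the induction: when \<open>v\<close> occurs twice,
    the summand of Euler's equation that removes \<open>v\<close> applies the matrix unit of
    \<open>v\<close> to a coefficient whose monomial still contains \<open>v\<close>.\<close>
  have "(2 \<le> count m v \<longrightarrow> ?E m = 0) \<and>
      (v \<in> pair_vars a b m \<longrightarrow> hop (created v) (destroyed v) (?E m) = 0)"
  proof (induction m rule: measure_induct_rule[where f = size])
    case (less m)
    show ?case
    proof (cases "pair_degree a b m = 0")
      case True
      then show ?thesis using V2 by (auto simp: exp_Gamma_deg_0 pair_degree_0)
    next
      case False
      have IH: "2 \<le> count (m - {#x#}) v \<Longrightarrow> ?E (m - {#x#}) = 0"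
        "v \<in> pair_vars a b (m - {#x#}) \<Longrightarrow> hop (created v) (destroyed v) (?E (m - {#x#})) = 0"
        if "x \<in> pair_vars a b m" for x
        using less[of "m - {#x#}"] that by (auto simp: pair_vars_def size_Diff1_less)
      have 1: "?E m = 0" if 2: "2 \<le> count m v"
      proof -
        have "hop (created x) (destroyed x) (?E (m - {#x#})) = 0" if x: "x \<in> pair_vars a b m" for x
        proof (cases "x = v")
          case True
          then have "v \<in> pair_vars a b (m - {#x#})"
            using 2 x by (auto simp: pair_vars_def in_diff_count)
          then show ?thesis using IH(2)[OF x] True by simp
        next
          case False
          then show ?thesis using IH(1)[OF x] 2 by simp
        qed
        then have "Gamma a b ?E m = 0" by (simp add: Gamma_eq)
        then show ?thesis using Gamma_Euler[of a b V, OF V] False smul_eq_0 by force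
      qed
      have 2: "hop (created v) (destroyed v) (?E m) = 0" if vm: "v \<in> pair_vars a b m"
      proof -
        have s: "snd (created x) = a" "snd (destroyed x) = b" if "x \<in> pair_vars a b m" for x
          using that snd_created snd_destroyed by (auto simp: pair_vars_def)
        \<comment> \<open>Creation takes place in component \<open>a\<close> and destruction in
          component \<open>b\<close>, so all matrix units of one pair commute and square to
          zero.\<close>
        then have ne: "created x \<noteq> destroyed y" if "x \<in> pair_vars a b m" "y \<in> pair_vars a b m" for x y
          using that ab(3) by metis
        have "hop (created v) (destroyed v) (hop (created x) (destroyed x) (?E (m - {#x#}))) = 0"
          if x: "x \<in> pair_vars a b m" for x
        proof (cases "x = v")
          case True
          then show ?thesis using hop_hop_same[OF E] s ne x ab by auto
        next
          case False
          then have "v \<in> pair_vars a b (m - {#x#})"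
            using vm by (auto simp: pair_vars_def in_diff_count)
          then have "hop (created v) (destroyed v) (?E (m - {#x#})) = 0" by (rule IH(2)[OF x])
          then show ?thesis
            using hop_hop[OF E[of "m - {#x#}"], of "created v" "created x" "destroyed x" "destroyed v"]
              s[OF x] s[OF vm] ne[OF x vm] ne[OF vm x] ab by simp
        qed
        then have "hop (created v) (destroyed v) (Gamma a b ?E m) = 0"
          by (simp add: Gamma_eq hop_sum)
        then show ?thesis using Gamma_Euler[of a b V m, OF V] False smul_eq_0 by (auto simp: hop_smul)
      qed
      from 1 2 show ?thesis by blast
    qed
  qed
  with v show ?thesis by blast
qed

lemma pair_degree_nonzero: "pair_degree a b m \<noteq> 0 \<Longrightarrow> \<exists>v. v \<in># m \<and> pair_of v = (a, b)"
  unfolding pair_degree_0 pair_vars_def by blast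

text \<open>The product over an arbitrary list of pairs, so that exponentials can be added one at a
  time.\<close>

definition exp_list :: "(nat \<times> nat) list \<Rightarrow> fock_series \<Rightarrow> fock_series" where
  "exp_list ps = foldr (\<lambda>(a, b). (\<circ>) (exp_Gamma a b)) ps id"

lemma exp_list_Nil [simp]: "exp_list [] V = V"
  and exp_list_Cons [simp]: "exp_list ((a, b) # ps) V = exp_Gamma a b (exp_list ps V)"
  by (simp_all add: exp_list_def)

abbreviation const_series :: "fock \<Rightarrow> fock_series" where
  "const_series v \<equiv> \<lambda>m. if m = {#} then v else 0"

text \<open>The three properties support one another: since the pairs are distinct, the second makes
  the variables of the next pair fresh, which Euler's equation for that pair requires.\<close>

lemma exp_list_properties:
  assumes "distinct ps" "\<And>a b. (a, b) \<in> set ps \<Longrightarrow> a < n \<and> b < n \<and> a \<noteq> b" "v \<in> Fock n"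
  shows "(\<forall>m. exp_list ps (const_series v) m \<in> Fock n) \<and>
    (\<forall>m x. x \<in># m \<longrightarrow> pair_of x \<notin> set ps \<longrightarrow> exp_list ps (const_series v) m = 0) \<and>
    (\<forall>m x. 2 \<le> count m x \<longrightarrow> exp_list ps (const_series v) m = 0)"
  using assms(1,2)
proof (induction ps)
  case Nil
  then show ?case using assms(3) by (auto simp: Fock_zero)
next
  case (Cons p ps)
  obtain a b where p: "p = (a, b)" by (cases p)
  let ?V = "exp_list ps (const_series v)"
  have ab: "(a, b) \<notin> set ps" "a < n" "b < n" "a \<noteq> b" using Cons.prems by (auto simp: p)
  have ps: "distinct ps" using Cons.prems(1) by simp
  note IH = Cons.IH[OF ps Cons.prems(2)[OF list.set_intros(2)]]
  then have V: "?V m \<in> Fock n" "x \<in># m \<Longrightarrow> pair_of x \<notin> set ps \<Longrightarrow> ?V m = 0" "2 \<le> count m x \<Longrightarrow> ?V m = 0" for m x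
    by blast+
  have V0: "?V m = 0" if "pair_degree a b m \<noteq> 0" for m
    using pair_degree_nonzero[OF that] V(2) ab(1) by metis
  show ?case
  proof (intro conjI allI impI)
    show "exp_list (p # ps) (const_series v) m \<in> Fock n" for m
      unfolding p exp_list_Cons by (rule Fock_exp_Gamma[OF ab(2) V(1)])
    show "exp_list (p # ps) (const_series v) m = 0"
      if "x \<in># m" "pair_of x \<notin> set (p # ps)" for m x
      unfolding p exp_list_Cons
      by (rule exp_Gamma_new_vars[where v = x]) (use V0 V(2) that p in auto)
    show "exp_list (p # ps) (const_series v) m = 0" if "2 \<le> count m x" for m x
      unfolding p exp_list_Cons
      by (rule exp_Gamma_multiplicity[OF ab(2-4) V(1) _ V(3) that]) (use V0 in auto)
  qed
qed

text \<open>For the empty product the operators move back from the test vectors to \<open>v\<close>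
  and \<open>v'\<close>, where \<open>Z\<close> annihilates every term; each exponential then
  preserves the vanishing.\<close>

lemma Omega_exp_list:
  assumes "distinct ps" "\<And>a b. (a, b) \<in> set ps \<Longrightarrow> a < n \<and> b < n \<and> a \<noteq> b"
    and v: "v \<in> Fock n" "v' \<in> Fock n" and u: "u \<in> Fock n" "w \<in> Fock n"
    and Z: "\<And>s. snd s < n \<Longrightarrow> wedge s v = 0 \<or> contract s v' = 0"
  shows "Omega u w (exp_list ps (const_series v)) (exp_list ps (const_series v')) = 0"
  using assms(1,2) u
proof (induction ps arbitrary: u w)
  case Nil
  have "pair_series (contract s u) (const_series v) * pair_series (wedge s w) (const_series v') = 0"
    if "s \<in> sites u w" for s
  proof -
    have "pairing (contract s u) v = 0 \<or> pairing (wedge s w) v' = 0"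
      using Z[OF sites_snd[OF Nil(3) that]] by (auto simp flip: pairing_wedge pairing_contract)
    moreover have "pair_series x (const_series y) = 0" if "pairing x y = 0" for x y
      using that by (auto simp: pair_series_def zero_mseries_def intro!: arg_cong[where f = Mseries])
    ultimately show ?thesis by auto
  qed
  then show ?case by (simp add: Omega_def)
next
  case (Cons p ps)
  obtain a b where p: "p = (a, b)" by (cases p)
  have ab: "(a, b) \<notin> set ps" "a < n" "b < n" using Cons.prems by (auto simp: p)
  have V0: "exp_list ps (const_series x) m = 0" if "pair_degree a b m \<noteq> 0" "x \<in> Fock n" for m x
    using pair_degree_nonzero[OF that(1)] exp_list_properties[of ps n x] Cons.prems that(2) ab(1)
    by (metis distinct.simps(2) list.set_intros(2))
  have "distinct ps" using Cons.prems(1) by simp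
  note IH = Cons.IH[OF this Cons.prems(2)[OF list.set_intros(2)]]
  show ?case unfolding p exp_list_Cons
    by (rule Omega_exp_Gamma[OF ab(2,3) V0 V0 IH]) (use v Cons.prems in auto)
qed

definition pairs :: "nat \<Rightarrow> (nat \<times> nat) list" where
  "pairs n = [(a, b). a \<leftarrow> [0..<n], b \<leftarrow> [0..<a]]"

lemma set_pairs: "(a, b) \<in> set (pairs n) \<longleftrightarrow> b < a \<and> a < n"
  by (auto simp: pairs_def image_iff)

lemma distinct_pairs: "distinct (pairs n)"
  unfolding pairs_def by (induction n) (auto simp: distinct_map inj_on_def)

lemma group_elt_eq: "group_elt n v = exp_list (pairs n) (const_series v)"
  by (simp add: group_elt_def group_elt_series_def exp_list_def pairs_def)

lemma Fock_group_elt: "v \<in> Fock n \<Longrightarrow> group_elt n v m \<in> Fock n"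
  and group_elt_vars: "v \<in> Fock n \<Longrightarrow> 2 \<le> count m x \<Longrightarrow> group_elt n v m = 0"
  using exp_list_properties[OF distinct_pairs, of n n v] unfolding group_elt_eq set_pairs by (blast dest: less_trans)+

lemma Omega_group_elt:
  assumes "v \<in> Fock n" "v' \<in> Fock n" "u \<in> Fock n" "w \<in> Fock n"
    and "\<And>s. snd s < n \<Longrightarrow> wedge s v = 0 \<or> contract s v' = 0"
  shows "Omega u w (group_elt n v) (group_elt n v') = 0"
  unfolding group_elt_eq by (rule Omega_exp_list[OF distinct_pairs _ assms]) (auto simp: set_pairs)


section \<open>Specialisation\<close>

text \<open>The index set of the sum in \<open>specialise\<close>. A sum over an infinite set is 0
  by convention, so compatibility with ring operations is claimed only where this set is
  finite.\<close>

definition spec_support :: "('v \<Rightarrow> complex) \<Rightarrow> 'v mseries \<Rightarrow> 'v multiset set" where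
  "spec_support x f = {m. mcoeff f m \<noteq> 0 \<and> (\<forall>c\<in>#m. x c \<noteq> 0)}"

lemma specialise_superset:
  assumes "finite A" "spec_support x f \<subseteq> A"
  shows "specialise x f = (\<Sum>m\<in>A. mcoeff f m * (\<Prod>c\<in>#m. x c))"
  unfolding specialise_def spec_support_def[symmetric]
  using assms by (intro sum.mono_neutral_left) (auto simp: spec_support_def prod_mset_zero_iff)

lemma spec_support_add: "spec_support x (f + g) \<subseteq> spec_support x f \<union> spec_support x g"
  by (auto simp: spec_support_def plus_mseries_def)

lemma specialise_add:
  assumes "finite (spec_support x f)" "finite (spec_support x g)"
  shows "finite (spec_support x (f + g))" "specialise x (f + g) = specialise x f + specialise x g"
proof -
  let ?A = "spec_support x f \<union> spec_support x g"
  show "finite (spec_support x (f + g))"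
    using assms by (intro finite_subset[OF spec_support_add]) auto
  have "specialise x h = (\<Sum>m\<in>?A. mcoeff h m * (\<Prod>c\<in>#m. x c))" if "spec_support x h \<subseteq> ?A" for h
    using assms that by (intro specialise_superset) auto
  then show "specialise x (f + g) = specialise x f + specialise x g"
    using spec_support_add[of x f g] by (simp add: mcoeff_add distrib_right sum.distrib)
qed

lemma specialise_0: "spec_support x 0 = {}" "specialise x 0 = 0"
  by (simp_all add: spec_support_def specialise_def zero_mseries_def)

lemma specialise_sum:
  assumes "\<And>i. i \<in> A \<Longrightarrow> finite (spec_support x (f i))"
  shows "specialise x (\<Sum>i\<in>A. f i) = (\<Sum>i\<in>A. specialise x (f i))"
proof -
  have "finite (spec_support x (\<Sum>i\<in>A. f i)) \<and> specialise x (\<Sum>i\<in>A. f i) = (\<Sum>i\<in>A. specialise x (f i))"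
    using assms by (induction A rule: infinite_finite_induct) (simp_all add: specialise_0 specialise_add)
  then show ?thesis by simp
qed

lemma specialise_mult:
  assumes f: "finite (spec_support x f)" and g: "finite (spec_support x g)"
  shows "finite (spec_support x (f * g))" "specialise x (f * g) = specialise x f * specialise x g"
proof -
  let ?F = "spec_support x f" and ?G = "spec_support x g"
  let ?A = "(\<lambda>(p, q). p + q) ` (?F \<times> ?G)"
  let ?t = "\<lambda>f m. mcoeff f m * (\<Prod>c\<in>#m. x c)"
  have sub: "spec_support x (f * g) \<subseteq> ?A"
  proof
    fix m assume m: "m \<in> spec_support x (f * g)"
    then have "(\<Sum>(p, q)\<in>{(p, q). p + q = m}. mcoeff f p * mcoeff g q) \<noteq> 0"
      by (simp add: spec_support_def times_mseries_def)
    then obtain p q where "p + q = m" "mcoeff f p * mcoeff g q \<noteq> 0"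
      by (auto elim!: sum.not_neutral_contains_not_neutral)
    with m show "m \<in> ?A" by (force simp: spec_support_def)
  qed
  have A: "finite ?A" using f g by simp
  show "finite (spec_support x (f * g))" by (rule finite_subset[OF sub A])
  have "specialise x (f * g) = (\<Sum>m\<in>?A. \<Sum>(p, q)\<in>{(p, q). p + q = m}. ?t f p * ?t g q)"
    unfolding specialise_superset[OF A sub] unfolding times_mseries_def mcoeff_Mseries sum_distrib_right
  proof (intro sum.cong refl)
    fix m and pq :: "'a multiset \<times> 'a multiset" assume "pq \<in> {(p, q). p + q = m}"
    then show "(case pq of (p, q) \<Rightarrow> mcoeff f p * mcoeff g q) * (\<Prod>c\<in>#m. x c) =
        (case pq of (p, q) \<Rightarrow> ?t f p * ?t g q)"
      by (auto simp: mult_ac)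
  qed
  also have "\<dots> = (\<Sum>(m, p, q)\<in>(SIGMA m:?A. {(p, q). p + q = m}). ?t f p * ?t g q)"
    using A by (subst sum.Sigma) (auto simp: finite_splittings case_prod_beta)
  \<comment> \<open>A splitting with a part outside its support contributes 0, because of a zero
    coefficient or of a variable with value 0.\<close>
  also have "\<dots> = (\<Sum>(m, p, q)\<in>(\<lambda>(p, q). (p + q, p, q)) ` (?F \<times> ?G). ?t f p * ?t g q)"
    using A
    by (intro sum.mono_neutral_right finite_SigmaI)
       (auto simp: finite_splittings spec_support_def image_iff prod_mset_zero_iff)
  also have "\<dots> = (\<Sum>(p, q)\<in>?F \<times> ?G. ?t f p * ?t g q)"
    by (subst sum.reindex) (auto simp: inj_on_def intro!: sum.cong)
  also have "\<dots> = specialise x f * specialise x g"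
    by (simp add: specialise_superset[OF f] specialise_superset[OF g] sum_product sum.cartesian_product)
  finally show "specialise x (f * g) = specialise x f * specialise x g" .
qed

lemma specialise_sign_pow: "finite (spec_support x (sign_pow e))" "specialise x (sign_pow e) = sign_pow e"
proof -
  have *: "mcoeff (sign_pow e) m = (if m = {#} then sign_pow e else 0)" for m :: "'a multiset"
    by (auto simp: sign_pow_def one_mseries_def uminus_mseries_def)
  have sub: "spec_support x (sign_pow e) \<subseteq> {{#}}"
    by (auto simp: spec_support_def * split: if_splits)
  then show "finite (spec_support x (sign_pow e))" by (rule finite_subset) simp
  show "specialise x (sign_pow e) = sign_pow e"
    using specialise_superset[OF _ sub] by (simp add: *)
qed


section \<open>The identity for the tau functions\<close>

lemma pair_series_smul_sign: "pair_series (smul (sign_pow e) u) V = sign_pow e * pair_series u V"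
proof -
  have "smul (-1) u = - u" by (rule poly_mapping_eqI) simp
  then show ?thesis by (simp add: sign_pow_def pair_series_uminus)
qed

context translation
begin

text \<open>Q^beta is an isometry and moves to the left as its inverse. This leaves a matrix
  coefficient of \<open>g\<close> itself, to which the invariance applies.\<close>

lemma tau_eq:
  "tau n Q k \<beta> = pair_series (Qinv \<beta> (Q_lattice n Q (- k) (v0 n))) (group_elt n (Qinv \<beta> (v0 n)))"
  unfolding tau_def conj_group_elt_def pair_series_def T_lattice_def
  by (simp add: pairing_Q_lattice_right Q_lattice_Fock v0_Fock Fock_group_elt Qinv_Fock)

lemma finite_spec_support_tau:
  assumes "finite {v. x v \<noteq> 0}"
  shows "finite (spec_support x (tau n Q k \<beta>))"
proof (rule finite_subset[OF _ finite_submultisets[of "mset_set {v. x v \<noteq> 0}"]])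
  show "spec_support x (tau n Q k \<beta>) \<subseteq> {m. m \<subseteq># mset_set {v. x v \<noteq> 0}}"
  proof
    fix m assume m: "m \<in> spec_support x (tau n Q k \<beta>)"
    have c: "count m v < 2" for v
    proof (rule ccontr)
      assume "\<not> count m v < 2"
      then have "group_elt n (Qinv \<beta> (v0 n)) m = 0"
        using group_elt_vars[OF Qinv_Fock[OF v0_Fock]] by (meson not_less)
      with m show False by (simp add: spec_support_def tau_eq pair_series_def)
    qed
    have "count m v \<le> count (mset_set {v. x v \<noteq> 0}) v" for v
    proof (cases "v \<in># m")
      case True
      then have "x v \<noteq> 0" using m by (simp add: spec_support_def)
      then show ?thesis using assms c[of v] by simp
    qed (simp add: not_in_iff)
    then show "m \<in> {m. m \<subseteq># mset_set {v. x v \<noteq> 0}}" by (simp add: mset_subset_eqI)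
  qed
qed

lemma Qinv_zero: "Qinv \<beta> 0 = 0"
  using Qinv_smul[OF Fock_zero, of \<beta> 0] by simp

lemma contract_Qinv:
  "a < n \<Longrightarrow> v \<in> Fock n \<Longrightarrow> contract (j, a) (Qinv \<beta> v) =
    smul (sign_pow (\<Sum>x\<in>{..<n} - {a}. \<beta> x)) (Qinv \<beta> (contract (j - \<beta> a, a) v))"
  by (rule intertwiner_Qinv[OF intertwiner_contract])

lemma wedge_Qinv:
  "a < n \<Longrightarrow> v \<in> Fock n \<Longrightarrow> wedge (j, a) (Qinv \<beta> v) =
    smul (sign_pow (\<Sum>x\<in>{..<n} - {a}. \<beta> x)) (Qinv \<beta> (wedge (j - \<beta> a, a) v))"
  by (rule intertwiner_Qinv[OF intertwiner_wedge])

text \<open>In component \<open>a\<close> the first vector is filled from level beta_a on and the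
  second from beta_a + eta_a on. As eta is non-negative, no site is empty in the first and filled in
  the second.\<close>

lemma Omega_tau:
  assumes "\<And>a. a < n \<Longrightarrow> 0 \<le> \<eta> a" "u \<in> Fock n" "w \<in> Fock n"
  shows "Omega u w (group_elt n (Qinv \<beta> (v0 n))) (group_elt n (Qinv (\<beta> + \<eta>) (v0 n))) = 0"
proof (rule Omega_group_elt[OF Qinv_Fock[OF v0_Fock] Qinv_Fock[OF v0_Fock] assms(2,3)])
  fix s :: site assume s: "snd s < n"
  obtain j a where ja: "s = (j, a)" by (cases s)
  have "0 \<le> j - \<beta> a \<or> j - (\<beta> + \<eta>) a < 0" using assms(1)[of a] s ja by auto
  then show "wedge s (Qinv \<beta> (v0 n)) = 0 \<or> contract s (Qinv (\<beta> + \<eta>) (v0 n)) = 0"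
    using s wedge_v0[of "j - \<beta> a" a] contract_v0[of "j - (\<beta> + \<eta>) a" a]
    unfolding ja by (auto simp: wedge_Qinv contract_Qinv v0_Fock Qinv_zero)
qed

text \<open>Pairing with $Q^{\gamma} v_0$ and $Q^{\gamma'} v_0$ leaves one term of the Casimir
  element for each \<open>a\<close> with $\gamma_a - \gamma'_a + \eta_a = 1$ and none if this number is \<open>0\<close>.\<close>

lemma tau_bilinear:
  assumes \<eta>: "\<And>a. a < n \<Longrightarrow> 0 \<le> \<eta> a" and K: "K \<subseteq> {..<n}"
    and diff: "\<And>a. a < n \<Longrightarrow> \<gamma> a - \<gamma>' a + \<eta> a = (if a \<in> K then 1 else 0)"
  shows "(\<Sum>a\<in>K. sign_pow (\<eta> a + (\<Sum>x<a. \<gamma> x + \<gamma>' x)) *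
    tau n Q (\<delta> a - \<gamma>) \<beta> * tau n Q (- \<gamma>' - \<delta> a) (\<beta> + \<eta>)) = 0"
proof -
  let ?u = "Qinv \<beta> (Q_lattice n Q \<gamma> (v0 n))"
  let ?w = "Qinv (\<beta> + \<eta>) (Q_lattice n Q \<gamma>' (v0 n))"
  let ?V = "group_elt n (Qinv \<beta> (v0 n))"
  let ?W = "group_elt n (Qinv (\<beta> + \<eta>) (v0 n))"
  \<comment> \<open>The lowest filled level -gamma_a of Q^gamma v_0, shifted by beta_a through the
    inverse of Q^beta.\<close>
  let ?s = "\<lambda>a. (\<beta> a - \<gamma> a, a)"
  \<comment> \<open>Passing both inverse translations costs the sum of 2 beta_x + eta_x over x
    different from a, that is, \<open>?C\<close> - eta_a modulo 2. The part \<open>?C\<close> is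
    common to all terms and is divided out at the end.\<close>
  let ?C = "\<Sum>x<n. \<eta> x"
  have F: "?u \<in> Fock n" "?w \<in> Fock n" by (intro Qinv_Fock Q_lattice_Fock v0_Fock)+
  have sites: "sites ?u ?w \<subseteq> ?s ` K"
  proof
    fix s assume s: "s \<in> sites ?u ?w"
    obtain j a where ja: "s = (j, a)" by (cases s)
    have a: "a < n" using sites_snd[OF F(1) s] ja by simp
    have "contract (j - \<beta> a, a) (Q_lattice n Q \<gamma> (v0 n)) \<noteq> 0"
      "wedge (j - (\<beta> + \<eta>) a, a) (Q_lattice n Q \<gamma>' (v0 n)) \<noteq> 0"
      using s a unfolding ja sites_def
      by (auto simp: contract_Qinv wedge_Qinv Q_lattice_Fock v0_Fock Qinv_zero)
    then have "- \<gamma> a \<le> j - \<beta> a" "j - (\<beta> + \<eta>) a < - \<gamma>' a"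
      using a contract_Q_lattice_v0 wedge_Q_lattice_v0 by (meson not_le)+
    with diff[OF a] have "a \<in> K" "j = \<beta> a - \<gamma> a" by (auto split: if_splits)
    then show "s \<in> ?s ` K" by (simp add: ja)
  qed
  have fin: "finite K" using K finite_subset by blast
  have summand: "pair_series (contract (?s a) ?u) ?V * pair_series (wedge (?s a) ?w) ?W =
      sign_pow ?C * (sign_pow (\<eta> a + (\<Sum>x<a. \<gamma> x + \<gamma>' x)) *
        tau n Q (\<delta> a - \<gamma>) \<beta> * tau n Q (- \<gamma>' - \<delta> a) (\<beta> + \<eta>))" if "a \<in> K" for a
  proof -
    let ?b = "\<Sum>x\<in>{..<n} - {a}. \<beta> x" and ?b' = "\<Sum>x\<in>{..<n} - {a}. (\<beta> + \<eta>) x"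
    have a: "a < n" using that K by auto
    \<comment> \<open>The same site is the highest empty level of the second vector, because the
      difference in \<open>diff\<close> is exactly 1.\<close>
    have "\<beta> a - \<gamma> a - (\<beta> + \<eta>) a = - \<gamma>' a - 1" using diff[OF a] that by simp
    then have w: "pair_series (wedge (?s a) ?w) ?W = sign_pow ?b' *
        (sign_pow (\<Sum>x<a. \<gamma>' x) * tau n Q (- \<gamma>' - \<delta> a) (\<beta> + \<eta>))"
      using a by (simp add: wedge_Qinv Q_lattice_Fock v0_Fock wedge_Q_lattice_v0_top Qinv_smul
          pair_series_smul_sign tau_eq add.commute del: smul_simps(3))
    have u: "pair_series (contract (?s a) ?u) ?V = sign_pow ?b *
        (sign_pow (\<Sum>x<a. \<gamma> x) * tau n Q (\<delta> a - \<gamma>) \<beta>)"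
      using a by (simp add: contract_Qinv Q_lattice_Fock v0_Fock contract_Q_lattice_v0_top Qinv_smul
          pair_series_smul_sign tau_eq del: smul_simps(3))
    have sign: "sign_pow ?b * sign_pow (\<Sum>x<a. \<gamma> x) * (sign_pow ?b' * sign_pow (\<Sum>x<a. \<gamma>' x)) =
        (sign_pow ?C * sign_pow (\<eta> a + (\<Sum>x<a. \<gamma> x + \<gamma>' x)) :: cvar mseries)"
      unfolding sign_pow_add[symmetric]
    proof (rule sign_pow_cong)
      have "?b' = ?b + (?C - \<eta> a)" using a by (simp add: sum.distrib sum_diff1)
      then show "even (?b + (\<Sum>x<a. \<gamma> x) + (?b' + (\<Sum>x<a. \<gamma>' x)) - (?C + (\<eta> a + (\<Sum>x<a. \<gamma> x + \<gamma>' x))))"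
        by (simp add: sum.distrib)
    qed
    have regroup: "(p * (q * X)) * (r * (s * Y)) = (p * q * (r * s)) * (X * Y)" for p q r s X Y :: "cvar mseries"
      by (simp add: mult_ac)
    show ?thesis unfolding u w regroup sign by (simp only: mult.assoc)
  qed
  have "0 = Omega ?u ?w ?V ?W" using Omega_tau[OF \<eta> F] by simp
  also have "\<dots> = (\<Sum>s\<in>?s ` K. pair_series (contract s ?u) ?V * pair_series (wedge s ?w) ?W)"
    using fin sites by (intro Omega_superset) auto
  also have "\<dots> = (\<Sum>a\<in>K. pair_series (contract (?s a) ?u) ?V * pair_series (wedge (?s a) ?w) ?W)"
    by (subst sum.reindex) (auto simp: inj_on_def)
  also have "\<dots> = sign_pow ?C * (\<Sum>a\<in>K. sign_pow (\<eta> a + (\<Sum>x<a. \<gamma> x + \<gamma>' x)) *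
        tau n Q (\<delta> a - \<gamma>) \<beta> * tau n Q (- \<gamma>' - \<delta> a) (\<beta> + \<eta>))"
    unfolding sum_distrib_left by (intro sum.cong refl summand)
  finally have "sign_pow ?C * (sign_pow ?C * (\<Sum>a\<in>K. sign_pow (\<eta> a + (\<Sum>x<a. \<gamma> x + \<gamma>' x)) *
        tau n Q (\<delta> a - \<gamma>) \<beta> * tau n Q (- \<gamma>' - \<delta> a) (\<beta> + \<eta>))) = 0"
    by simp
  then show ?thesis by (simp add: sign_pow_def split: if_splits)
qed

end

section \<open>Comparison of the signs with the cocycle\<close>

lemma sum_lessThan_delta: "(\<Sum>x<a. \<delta> p x) = (if p < a then 1 else 0)"
  by (simp add: \<delta>_def)

lemma epsilon_delta_diff:
  assumes "p < n" "q < n"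
  shows "\<epsilon> n (\<delta> p - \<delta> q) \<rho> = sign_pow ((\<Sum>x<p. \<rho> x) - (\<Sum>x<q. \<rho> x))"
proof -
  have d: "(\<Sum>a\<in>{1..<n}. \<delta> r a * (\<Sum>b<a. \<rho> b)) = (\<Sum>x<r. \<rho> x)" if "r < n" for r
  proof -
    have "(\<Sum>a\<in>{1..<n}. \<delta> r a * (\<Sum>b<a. \<rho> b)) = (\<Sum>a\<in>{1..<n}. if a = r then \<Sum>b<r. \<rho> b else 0)"
      by (intro sum.cong) (auto simp: \<delta>_def)
    \<comment> \<open>The cocycle sum starts at index 1; for r = 0 the right-hand side is an empty
      sum.\<close>
    then show ?thesis using that by (cases "r = 0") auto
  qed
  show ?thesis using d assms by (simp add: \<epsilon>_def left_diff_distrib sum_subtractf)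
qed

lemma epsilon_delta: assumes "p < n" shows "\<epsilon> n (\<delta> p) (\<delta> q) = sign_pow (if q < p then 1 else 0)"
proof -
  have "(\<Sum>a\<in>{1..<n}. \<delta> p a * (\<Sum>b<a. \<delta> q b)) = (\<Sum>a\<in>{1..<n}. if a = p then \<Sum>b<p. \<delta> q b else 0)"
    by (intro sum.cong) (auto simp: \<delta>_def)
  then show ?thesis using assms by (cases "p = 0") (auto simp: \<epsilon>_def sum_lessThan_delta)
qed

lemma dot_delta_diff: "p < n \<Longrightarrow> q < n \<Longrightarrow> dot n \<rho> (\<delta> p - \<delta> q) = \<rho> p - \<rho> q"
  by (simp add: dot_def \<delta>_def right_diff_distrib sum_subtractf if_distrib[of "(*) _"] cong: if_cong)

text \<open>Normalising the coefficient of the term for \<open>c\<close> to \<open>1\<close>.\<close>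

lemma sign_identity:
  fixes F G :: "nat \<Rightarrow> 'a::comm_ring_1"
  assumes I: "I \<subseteq> {..<n}" and b: "b \<in> {..<n} - I" and c: "c \<in> {..<n} - I" and bc: "b \<noteq> c"
    and \<rho>: "\<And>a. a < n \<Longrightarrow> \<rho> a = (if a \<in> I then 1 else 0) - \<eta> a"
    and zero: "(\<Sum>a\<in>insert b (insert c I).
      sign_pow (\<eta> a + (\<Sum>x<a. \<rho> x + \<delta> b x + \<delta> c x)) * F a * G a) = 0"
  shows "F c * G c - sign_pow (dot n \<rho> (\<delta> b - \<delta> c)) * \<epsilon> n (\<delta> b - \<delta> c) \<rho> * F b * G b
    - (\<Sum>i\<in>I. sign_pow (dot n \<rho> (\<delta> i - \<delta> c)) * \<epsilon> n (\<delta> i - \<delta> c) \<rho>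
        * \<epsilon> n (\<delta> b) (\<delta> c) * \<epsilon> n (\<delta> b) (\<delta> i) * \<epsilon> n (\<delta> i) (\<delta> c) * F i * G i) = 0"
proof -
  let ?e = "\<lambda>a. \<eta> a + (\<Sum>x<a. \<rho> x + \<delta> b x + \<delta> c x)"
  have fin: "finite I" using I finite_subset by blast
  have e: "?e a = \<eta> a + (\<Sum>x<a. \<rho> x) + (if b < a then 1 else 0) + (if c < a then 1 else 0)" for a
    by (simp add: sum.distrib sum_lessThan_delta)
  have neg: "sign_pow (x + 1) = (- sign_pow x :: 'a)" for x by (simp add: sign_pow_def)
  \<comment> \<open>The minus sign records that exactly one of b < c and c < b holds.\<close>
  have B: "sign_pow (?e c) * sign_pow (?e b) =
      (- (sign_pow (dot n \<rho> (\<delta> b - \<delta> c)) * \<epsilon> n (\<delta> b - \<delta> c) \<rho>) :: 'a)"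
    unfolding sign_pow_add[symmetric] neg[symmetric] e using b c bc
    by (simp add: epsilon_delta_diff dot_delta_diff \<rho> flip: sign_pow_add neg) (auto intro!: sign_pow_cong)
  \<comment> \<open>Here the minus sign comes from the summand 1 of \<open>\<rho> i\<close>. The
    three cocycle factors account for the order of b, c and i: the comparisons of b with c and of b
    with i contribute 1 each, that of c with i occurs twice.\<close>
  have I': "sign_pow (?e c) * sign_pow (?e i) =
      (- (sign_pow (dot n \<rho> (\<delta> i - \<delta> c)) * \<epsilon> n (\<delta> i - \<delta> c) \<rho>
        * \<epsilon> n (\<delta> b) (\<delta> c) * \<epsilon> n (\<delta> b) (\<delta> i) * \<epsilon> n (\<delta> i) (\<delta> c)) :: 'a)" if "i \<in> I" for i
  proof -
    have i: "i < n" "i \<noteq> b" "i \<noteq> c" using that I b c by auto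
    show ?thesis
      unfolding e using b c bc i that
      by (simp add: epsilon_delta_diff epsilon_delta dot_delta_diff \<rho> flip: sign_pow_add neg)
         (auto intro!: sign_pow_cong)
  qed
  have "0 = sign_pow (?e c) * (\<Sum>a\<in>insert b (insert c I). sign_pow (?e a) * F a * G a)"
    using zero by simp
  also have "\<dots> = sign_pow (?e c) * sign_pow (?e b) * F b * G b + sign_pow (?e c) * sign_pow (?e c) * F c * G c +
      (\<Sum>i\<in>I. sign_pow (?e c) * sign_pow (?e i) * F i * G i)"
    using b c bc fin by (simp add: distrib_left sum_distrib_left mult.assoc)
  also have "sign_pow (?e c) * sign_pow (?e c) = (1 :: 'a)" by (simp add: sign_pow_def)
  also have "(\<Sum>i\<in>I. sign_pow (?e c) * sign_pow (?e i) * F i * G i) =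
     - (\<Sum>i\<in>I. sign_pow (dot n \<rho> (\<delta> i - \<delta> c)) * \<epsilon> n (\<delta> i - \<delta> c) \<rho>
        * \<epsilon> n (\<delta> b) (\<delta> c) * \<epsilon> n (\<delta> b) (\<delta> i) * \<epsilon> n (\<delta> i) (\<delta> c) * F i * G i)"
    unfolding sum_negf[symmetric] by (intro sum.cong refl) (simp add: I')
  finally show ?thesis unfolding B by (simp add: algebra_simps)
qed

theorem theorem14p1:
  fixes n d b c :: nat
    and Q :: "nat \<Rightarrow> fock \<Rightarrow> fock"
    and I :: "nat set"
    and \<delta>I \<delta>J \<rho> k \<beta> :: "nat \<Rightarrow> int"
  assumes "n \<ge> 2"
    and "translation_ops n Q"
    and "1 \<le> d" and "d \<le> n - 2"
    and "I \<subseteq> {..<n}" and "card I = d" and "\<delta>I = (\<Sum>i\<in>I. \<delta> i)"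
    and "\<delta>J \<in> int_lattice n" and "\<forall>a<n. \<delta>J a \<ge> 0" and "(\<Sum>a<n. \<delta>J a) = int d"
    and "\<rho> = \<delta>I - \<delta>J"
    and "b \<in> {..<n} - I" and "c \<in> {..<n} - I" and "b \<noteq> c"
    and "k \<in> root_lattice n" and "\<beta> \<in> int_lattice n"
  shows "(tau n Q (k + \<delta> c - \<delta> b) \<beta> * tau n Q (k + \<rho>) (\<beta> + \<delta>J)
      - sign_pow (dot n \<rho> (\<delta> b - \<delta> c)) * \<epsilon> n (\<delta> b - \<delta> c) \<rho>
          * tau n Q k \<beta> * tau n Q (k + \<rho> + \<delta> c - \<delta> b) (\<beta> + \<delta>J)
      - (\<Sum>i\<in>I. sign_pow (dot n \<rho> (\<delta> i - \<delta> c)) * \<epsilon> n (\<delta> i - \<delta> c) \<rho>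
          * \<epsilon> n (\<delta> b) (\<delta> c) * \<epsilon> n (\<delta> b) (\<delta> i) * \<epsilon> n (\<delta> i) (\<delta> c)
          * tau n Q (k + \<delta> i - \<delta> b) \<beta> * tau n Q (k + \<rho> + \<delta> c - \<delta> i) (\<beta> + \<delta>J)) = 0) \<and>
    (\<forall>x. finite {v. x v \<noteq> 0} \<longrightarrow>
      specialise x (tau n Q (k + \<delta> c - \<delta> b) \<beta>) * specialise x (tau n Q (k + \<rho>) (\<beta> + \<delta>J))
      - sign_pow (dot n \<rho> (\<delta> b - \<delta> c)) * \<epsilon> n (\<delta> b - \<delta> c) \<rho>
          * specialise x (tau n Q k \<beta>) * specialise x (tau n Q (k + \<rho> + \<delta> c - \<delta> b) (\<beta> + \<delta>J))
      - (\<Sum>i\<in>I. sign_pow (dot n \<rho> (\<delta> i - \<delta> c)) * \<epsilon> n (\<delta> i - \<delta> c) \<rho>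
          * \<epsilon> n (\<delta> b) (\<delta> c) * \<epsilon> n (\<delta> b) (\<delta> i) * \<epsilon> n (\<delta> i) (\<delta> c)
          * specialise x (tau n Q (k + \<delta> i - \<delta> b) \<beta>)
          * specialise x (tau n Q (k + \<rho> + \<delta> c - \<delta> i) (\<beta> + \<delta>J))) = 0)"
proof -
  interpret translation n Q by unfold_locales (rule assms)
  let ?K = "insert b (insert c I)"
  let ?F = "\<lambda>a. tau n Q (k + \<delta> a - \<delta> b) \<beta>" and ?G = "\<lambda>a. tau n Q (k + \<rho> + \<delta> c - \<delta> a) (\<beta> + \<delta>J)"
  let ?e = "\<lambda>a. \<delta>J a + (\<Sum>x<a. \<rho> x + \<delta> b x + \<delta> c x)"
  \<comment> \<open>Forced by the indices of the two tau-functions in the theorem: these must be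
    \<open>\<delta> a - \<gamma>\<close> and \<open>- \<gamma>' - \<delta> a\<close>.\<close>
  define \<gamma> \<gamma>' where "\<gamma> = \<delta> b - k" and "\<gamma>' = - (k + \<rho> + \<delta> c)"
  have fin: "finite I" using assms(5) finite_subset by blast
  have "\<delta>I a = (if a \<in> I then 1 else 0)" for a
  proof -
    have "(\<Sum>i\<in>I. \<delta> i) a = (\<Sum>i\<in>I. \<delta> i a)" using fin by (induction I rule: finite_induct) auto
    then show ?thesis using fin by (simp add: assms(7) \<delta>_def)
  qed
  then have \<rho>: "\<rho> a = (if a \<in> I then 1 else 0) - \<delta>J a" for a by (simp add: assms(11))
  have "(\<Sum>a\<in>?K. sign_pow (\<delta>J a + (\<Sum>x<a. \<gamma> x + \<gamma>' x)) *
      tau n Q (\<delta> a - \<gamma>) \<beta> * tau n Q (- \<gamma>' - \<delta> a) (\<beta> + \<delta>J)) = 0"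
  proof (rule tau_bilinear)
    show "\<gamma> a - \<gamma>' a + \<delta>J a = (if a \<in> ?K then 1 else 0)" for a
      using assms(12,13,14) by (auto simp: \<gamma>_def \<gamma>'_def \<rho> \<delta>_def)
  qed (use assms in auto)
  also have "(\<Sum>a\<in>?K. sign_pow (\<delta>J a + (\<Sum>x<a. \<gamma> x + \<gamma>' x)) *
      tau n Q (\<delta> a - \<gamma>) \<beta> * tau n Q (- \<gamma>' - \<delta> a) (\<beta> + \<delta>J)) = (\<Sum>a\<in>?K. sign_pow (?e a) * ?F a * ?G a)"
  proof (intro sum.cong refl arg_cong2[where f = "(*)"] arg_cong2[where f = "tau n Q"] sign_pow_cong)
    fix a
    \<comment> \<open>Modulo 2 the dependence on \<open>k\<close> disappears, so the coefficients
      are the same for all \<open>k\<close>.\<close>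
    have "(\<Sum>x<a. \<gamma> x + \<gamma>' x) = (\<Sum>x<a. \<rho> x + \<delta> b x + \<delta> c x) - 2 * (\<Sum>x<a. k x + \<rho> x + \<delta> c x)"
      unfolding sum_distrib_left sum_subtractf[symmetric]
      by (intro sum.cong) (auto simp: \<gamma>_def \<gamma>'_def)
    then show "even (\<delta>J a + (\<Sum>x<a. \<gamma> x + \<gamma>' x) - ?e a)" by simp
  qed (auto simp: \<gamma>_def \<gamma>'_def)
  finally have Z: "(\<Sum>a\<in>?K. sign_pow (?e a) * ?F a * ?G a) = 0" .
  \<comment> \<open>Valid over any commutative ring: it serves both for power series and, after
    specialising the sum \<open>Z\<close>, for complex numbers.\<close>
  note id = sign_identity[OF assms(5,12,13,14) \<rho>]
  have "(\<Sum>a\<in>?K. sign_pow (?e a) * specialise x (?F a) * specialise x (?G a)) = 0" if "finite {v. x v \<noteq> 0}" for x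
  proof -
    note fs = finite_spec_support_tau[OF that]
    have "(\<Sum>a\<in>?K. sign_pow (?e a) * specialise x (?F a) * specialise x (?G a)) =
        specialise x (\<Sum>a\<in>?K. sign_pow (?e a) * ?F a * ?G a)"
      by (simp only: specialise_sum specialise_mult specialise_sign_pow fs)
    then show ?thesis by (simp only: Z specialise_0)
  qed
  from id[OF this] id[OF Z] show ?thesis by simp
qed

end
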